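(* There exists an uncountable set $\mathcal T\subset C(I)$ of crooked $0$-attracted interval maps such that any two different $f,g\in\mathcal T$ are not topologically conjugate.
   Context: $I=[0,1]$. A map $f\colon I\to I$ is a continuous surjective function, and $C(I)$ denotes the set of all such interval maps. A map $f\in C(I)$ is $0$-attracted if $f(0)=0$, $f(1)=1$ and $f(x)<x$ for every $x\in(0,1)$. Maps $f,g\in C(I)$ are (topologically) conjugate if there is a homeomorphism $h\colon I\to I$ with $g=h\circ f\circ h^{-1}$. For $a,b\in I$ and $\delta>0$, a map $f$ is $\delta$-crooked between $a$ and $b$ if for every two points $c,d\in I$ with $f(c)=a$ and $f(d)=b$ there is a point $c'$ between $c$ and $d$ and a point $d'$ between $c'$ and $d$ such that $|b-f(c')|<\delta$ and $|a-f(d')|<\delta$ ("between" allows endpoints). The map $f$ is $\delta$-crooked if it is $\delta$-crooked between every pair of points of $I$. The map $f$ is crooked if for every $\delta>0$ there exists $n\in\mathbb N$ such that $f^n$ is $\delta$-crooked. *)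

theory Defs
  imports "HOL-Analysis.Analysis"
begin

abbreviation unit_I :: "real set" where
  "unit_I \<equiv> {0..1}"

text \<open>
  Functions on the unit interval are total functions on the reals. Membership in
  \<open>extensional\<close> fixes an interval map outside the interval, so that equality of
  interval maps is equality on the interval.
\<close>

definition interval_maps :: "(real \<Rightarrow> real) set" where
  "interval_maps =
     {f \<in> extensional unit_I. continuous_on unit_I f \<and> f ` unit_I = unit_I}"

definition zero_attracted :: "(real \<Rightarrow> real) \<Rightarrow> bool" where
  "zero_attracted f \<longleftrightarrow>
     f \<in> interval_maps \<and> f 0 = 0 \<and> f 1 = 1 \<and> (\<forall>x\<in>{0<..<1}. f x < x)"

definition conjugate_maps :: "(real \<Rightarrow> real) \<Rightarrow> (real \<Rightarrow> real) \<Rightarrow> bool" where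
  "conjugate_maps f g \<longleftrightarrow>
     (\<exists>h k. homeomorphism unit_I unit_I h k \<and> (\<forall>x\<in>unit_I. g x = h (f (k x))))"

text \<open>
  The order of \<open>c\<close> and \<open>d\<close> is arbitrary; \<open>closed_segment\<close> is symmetric in its end points.
\<close>

definition delta_crooked_between ::
  "real \<Rightarrow> (real \<Rightarrow> real) \<Rightarrow> real \<Rightarrow> real \<Rightarrow> bool" where
  "delta_crooked_between \<delta> f a b \<longleftrightarrow>
     (\<forall>c\<in>unit_I. \<forall>d\<in>unit_I. f c = a \<and> f d = b \<longrightarrow>
        (\<exists>c'\<in>closed_segment c d. \<exists>d'\<in>closed_segment c' d.
           \<bar>b - f c'\<bar> < \<delta> \<and> \<bar>a - f d'\<bar> < \<delta>))"

definition delta_crooked :: "real \<Rightarrow> (real \<Rightarrow> real) \<Rightarrow> bool" where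
  "delta_crooked \<delta> f \<longleftrightarrow> (\<forall>a\<in>unit_I. \<forall>b\<in>unit_I. delta_crooked_between \<delta> f a b)"

text \<open>
  On the unit interval, the iterate \<open>f ^^ n\<close> of an interval map only involves the values of
  \<open>f\<close> there. Exponents are taken to be positive.
\<close>

definition crooked :: "(real \<Rightarrow> real) \<Rightarrow> bool" where
  "crooked f \<longleftrightarrow> (\<forall>\<delta>>0. \<exists>n\<ge>1. delta_crooked \<delta> (f ^^ n))"

end

(*
  The interval is unrolled to [0,oo) by x/(1+x). There the map moves points to the left by a
  bounded amount and zigzags: it has vertices at the integers i, with values i - 8 (i even) and
  i - 2 (i odd), and between two integers it runs through a more and more crooked path as i grows.

  Call [x,y] strict if every value inside lies strictly between the values at the two ends. A
  strict interval either lies between two consecutive integers or is stretched by at least 2.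
  Pulling two values at distance at most 2k back through k iterates, each time passing to a strict
  subinterval, therefore leads to two points between consecutive integers, where the path was
  chosen crooked enough compared with the Lipschitz constants of all earlier pieces. So the k-th
  iterate is nearly crooked for pairs in [0,2k].

  The family comes from making the map constant to the right of some odd vertices: the times after
  which these plateaus reach 0 form an arbitrary set of numbers, which conjugacy preserves.
*)

theory Submission
  imports Defs
begin

section \<open>Crooked paths\<close>

text \<open>Only \<open>c \<le> d\<close> occurs: read from right to left, \<open>u\<close> and
  \<open>v\<close> exchange roles. The interval varies so that paths can be pieced together.\<close>

definition crooked_on :: "real \<Rightarrow> (real \<Rightarrow> real) \<Rightarrow> real \<Rightarrow> real \<Rightarrow> bool" where
  "crooked_on \<epsilon> p x y \<longleftrightarrow> (\<forall>c d. x \<le> c \<and> c \<le> d \<and> d \<le> y \<longrightarrow>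
     (\<exists>u v. c \<le> u \<and> u \<le> v \<and> v \<le> d \<and> \<bar>p u - p d\<bar> \<le> \<epsilon> \<and> \<bar>p v - p c\<bar> \<le> \<epsilon>))"

lemma crooked_onD:
  assumes "crooked_on \<epsilon> p x y" "x \<le> c" "c \<le> d" "d \<le> y"
  shows "\<exists>u v. c \<le> u \<and> u \<le> v \<and> v \<le> d \<and> \<bar>p u - p d\<bar> \<le> \<epsilon> \<and> \<bar>p v - p c\<bar> \<le> \<epsilon>"
  using assms unfolding crooked_on_def by blast

text \<open>The same \<open>u\<close> and \<open>v\<close> serve. This covers affine changes of the
  values and following a path by a Lipschitz map.\<close>

lemma crooked_on_dominated:
  assumes "crooked_on \<epsilon> p x y" "0 \<le> K" "K * \<epsilon> \<le> \<epsilon>'"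
    and dom: "\<And>s t. \<lbrakk>x \<le> s; s \<le> y; x \<le> t; t \<le> y\<rbrakk> \<Longrightarrow> \<bar>q s - q t\<bar> \<le> K * \<bar>p s - p t\<bar>"
  shows "crooked_on \<epsilon>' q x y"
  unfolding crooked_on_def
proof (intro allI impI, elim conjE)
  fix c d assume cd: "x \<le> c" "c \<le> d" "d \<le> y"
  obtain u v where uv: "c \<le> u" "u \<le> v" "v \<le> d" "\<bar>p u - p d\<bar> \<le> \<epsilon>" "\<bar>p v - p c\<bar> \<le> \<epsilon>"
    using crooked_onD[OF assms(1) cd] by blast
  have "K * \<bar>p u - p d\<bar> \<le> K * \<epsilon>" "K * \<bar>p v - p c\<bar> \<le> K * \<epsilon>"
    using uv assms(2) by (auto intro: mult_left_mono)
  then show "\<exists>u v. c \<le> u \<and> u \<le> v \<and> v \<le> d \<and> \<bar>q u - q d\<bar> \<le> \<epsilon>' \<and> \<bar>q v - q c\<bar> \<le> \<epsilon>'"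
    using uv cd dom[of u d] dom[of v c] assms(3) by (intro exI[of _ u] exI[of _ v]) auto
qed

text \<open>\<open>U\<close> and \<open>V\<close> lift through \<open>g\<close> by the intermediate
  value theorem; \<open>V\<close> is lifted to the right of \<open>u\<close>, which keeps the
  order.\<close>

lemma crooked_on_compose:
  assumes "crooked_on \<epsilon> p X Y" "continuous_on {x..y} g" "mono_on {x..y} g"
    and "\<And>t. x \<le> t \<Longrightarrow> t \<le> y \<Longrightarrow> X \<le> g t \<and> g t \<le> Y"
  shows "crooked_on \<epsilon> (\<lambda>t. p (g t)) x y"
  unfolding crooked_on_def
proof (intro allI impI, elim conjE)
  fix c d assume cd: "x \<le> c" "c \<le> d" "d \<le> y"
  have "g c \<le> g d" using cd assms(3) by (auto simp: mono_on_def)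
  then obtain U V where UV: "g c \<le> U" "U \<le> V" "V \<le> g d"
      "\<bar>p U - p (g d)\<bar> \<le> \<epsilon>" "\<bar>p V - p (g c)\<bar> \<le> \<epsilon>"
    using crooked_onD[OF assms(1), of "g c" "g d"] assms(4)[of c] assms(4)[of d] cd by fastforce
  obtain u where u: "c \<le> u" "u \<le> d" "g u = U"
    using IVT'[of g c U d] UV cd continuous_on_subset[OF assms(2), of "{c..d}"] by auto
  obtain v where v: "u \<le> v" "v \<le> d" "g v = V"
    using IVT'[of g u V d] UV cd u continuous_on_subset[OF assms(2), of "{u..d}"] by auto
  show "\<exists>u v. c \<le> u \<and> u \<le> v \<and> v \<le> d \<and> \<bar>p (g u) - p (g d)\<bar> \<le> \<epsilon> \<and> \<bar>p (g v) - p (g c)\<bar> \<le> \<epsilon>"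
    using u v UV by (intro exI[of _ u] exI[of _ v]) auto
qed

text \<open>For \<open>c\<close> and \<open>d\<close> on different sides of the peak, the side of
  the lower end climbs through the value at the other end at some \<open>w\<close>, and the
  crookedness of this one side suffices.\<close>

lemma crooked_on_peak:
  assumes p: "crooked_on \<epsilon> p x m" "crooked_on \<epsilon> p m y" "continuous_on {x..y} p" "x \<le> m" "m \<le> y"
    and top: "\<And>t. x \<le> t \<Longrightarrow> t \<le> y \<Longrightarrow> p t \<le> p m"
  shows "crooked_on \<epsilon> p x y"
  unfolding crooked_on_def
proof (intro allI impI, elim conjE)
  fix c d assume cd: "x \<le> c" "c \<le> d" "d \<le> y"
  have cont: "continuous_on {s..t} p" if "x \<le> s" "t \<le> y" for s t
    using continuous_on_subset[OF p(3)] that by simp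
  consider "d \<le> m" | "m \<le> c" | "c \<le> m" "m \<le> d" "p c \<le> p d" | "c \<le> m" "m \<le> d" "p d \<le> p c"
    by linarith
  then show "\<exists>u v. c \<le> u \<and> u \<le> v \<and> v \<le> d \<and> \<bar>p u - p d\<bar> \<le> \<epsilon> \<and> \<bar>p v - p c\<bar> \<le> \<epsilon>"
  proof cases
    case 1
    then show ?thesis using crooked_onD[OF p(1), of c d] cd by auto
  next
    case 2
    then show ?thesis using crooked_onD[OF p(2), of c d] cd by auto
  next
    case 3
    obtain w where w: "c \<le> w" "w \<le> m" "p w = p d"
      using IVT'[of p c "p d" m] 3 cd top[of d] cont[of c m] p(4,5) by auto
    obtain u v where "c \<le> u" "u \<le> v" "v \<le> w" "\<bar>p u - p w\<bar> \<le> \<epsilon>" "\<bar>p v - p c\<bar> \<le> \<epsilon>"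
      using crooked_onD[OF p(1), of c w] cd w by auto
    with w 3 show ?thesis by (intro exI[of _ u] exI[of _ v]) auto
  next
    case 4
    obtain w where w: "m \<le> w" "w \<le> d" "p w = p c"
      using IVT2'[of p d "p c" m] 4 cd top[of c] cont[of m d] p(4,5) by auto
    obtain u v where "w \<le> u" "u \<le> v" "v \<le> d" "\<bar>p u - p d\<bar> \<le> \<epsilon>" "\<bar>p v - p w\<bar> \<le> \<epsilon>"
      using crooked_onD[OF p(2), of w d] cd w by auto
    with w 4 show ?thesis by (intro exI[of _ u] exI[of _ v]) auto
  qed
qed

lemma crooked_on_valley:
  assumes p: "crooked_on \<epsilon> p x m" "crooked_on \<epsilon> p m y" "continuous_on {x..y} p" "x \<le> m" "m \<le> y"
    and bot: "\<And>t. x \<le> t \<Longrightarrow> t \<le> y \<Longrightarrow> p m \<le> p t"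
  shows "crooked_on \<epsilon> p x y"
proof -
  have "crooked_on \<epsilon> (\<lambda>t. - p t) x y"
  proof (rule crooked_on_peak[where m = m])
    show "crooked_on \<epsilon> (\<lambda>t. - p t) x m" by (rule crooked_on_dominated[OF p(1), of 1]) auto
    show "crooked_on \<epsilon> (\<lambda>t. - p t) m y" by (rule crooked_on_dominated[OF p(2), of 1]) auto
  qed (use p bot in \<open>auto intro!: continuous_intros\<close>)
  from crooked_on_dominated[OF this, of 1 \<epsilon> p] show ?thesis by auto
qed

text \<open>The new case has \<open>c\<close> on the first leg and \<open>d\<close> on the last. If
  \<open>p c \<le> p d\<close>, then \<open>u\<close> is found on the first leg and \<open>v\<close>
  on the middle one, with \<open>l\<close> or \<open>r\<close> as substitute for a value beyond the
  turning points. If \<open>p d \<le> p c\<close>, the middle leg runs through both values in this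
  order and its own crookedness applies.\<close>

lemma crooked_on_zigzag:
  assumes p: "crooked_on \<epsilon> p x l" "crooked_on \<epsilon> p l r" "crooked_on \<epsilon> p r y"
    and cont: "continuous_on {x..y} p" and ord: "x \<le> l" "l \<le> r" "r \<le> y"
    and top: "\<And>t. x \<le> t \<Longrightarrow> t \<le> r \<Longrightarrow> p t \<le> p l"
    and bot: "\<And>t. l \<le> t \<Longrightarrow> t \<le> y \<Longrightarrow> p r \<le> p t"
    and over: "\<And>t. r \<le> t \<Longrightarrow> t \<le> y \<Longrightarrow> p t \<le> p l + \<epsilon>"
    and under: "\<And>t. x \<le> t \<Longrightarrow> t \<le> l \<Longrightarrow> p r - \<epsilon> \<le> p t"
    and eps: "0 \<le> \<epsilon>"
  shows "crooked_on \<epsilon> p x y"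
  unfolding crooked_on_def
proof (intro allI impI, elim conjE)
  fix c d assume cd: "x \<le> c" "c \<le> d" "d \<le> y"
  have cont': "continuous_on {s..t} p" if "x \<le> s" "t \<le> y" for s t
    using continuous_on_subset[OF cont] that by simp
  have left: "crooked_on \<epsilon> p x r"
    by (rule crooked_on_peak[OF p(1,2) cont']) (use ord top in auto)
  have right: "crooked_on \<epsilon> p l y"
    by (rule crooked_on_valley[OF p(2,3) cont']) (use ord bot in auto)
  consider "d \<le> r" | "l \<le> c" | "c \<le> l" "r \<le> d" "p c \<le> p d" | "c \<le> l" "r \<le> d" "p d \<le> p c"
    by linarith
  then show "\<exists>u v. c \<le> u \<and> u \<le> v \<and> v \<le> d \<and> \<bar>p u - p d\<bar> \<le> \<epsilon> \<and> \<bar>p v - p c\<bar> \<le> \<epsilon>"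
  proof cases
    case 1
    then show ?thesis using crooked_onD[OF left, of c d] cd by auto
  next
    case 2
    then show ?thesis using crooked_onD[OF right, of c d] cd by auto
  next
    case 3
    have "\<exists>u. c \<le> u \<and> u \<le> l \<and> \<bar>p u - p d\<bar> \<le> \<epsilon>"
    proof (cases "p d \<le> p l")
      case True
      then obtain u where "c \<le> u" "u \<le> l" "p u = p d"
        using IVT'[of p c "p d" l] 3 cd cont'[of c l] ord by auto
      then show ?thesis using eps by (intro exI[of _ u]) auto
    next
      case False
      then show ?thesis using over[of d] 3 cd by (intro exI[of _ l]) auto
    qed
    moreover have "\<exists>v. l \<le> v \<and> v \<le> r \<and> \<bar>p v - p c\<bar> \<le> \<epsilon>"
    proof (cases "p r \<le> p c")
      case True
      then obtain v where "l \<le> v" "v \<le> r" "p v = p c"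
        using IVT2'[of p r "p c" l] 3 cd cont'[of l r] ord top[of c] by auto
      then show ?thesis using eps by (intro exI[of _ v]) auto
    next
      case False
      then show ?thesis using under[of c] 3 cd ord by (intro exI[of _ r]) auto
    qed
    ultimately show ?thesis using 3 by (metis order.trans)
  next
    case 4
    obtain w where w: "l \<le> w" "w \<le> r" "p w = p c"
      using IVT2'[of p r "p c" l] 4 cd cont'[of l r] ord top[of c] bot[of d] by auto
    obtain w' where w': "w \<le> w'" "w' \<le> r" "p w' = p d"
      using IVT2'[of p r "p d" w] 4 cd cont'[of w r] ord w bot[of d] by auto
    obtain u v where "w \<le> u" "u \<le> v" "v \<le> w'" "\<bar>p u - p w'\<bar> \<le> \<epsilon>" "\<bar>p v - p w\<bar> \<le> \<epsilon>"
      using crooked_onD[OF p(2), of w w'] w w' by auto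
    with w w' 4 ord show ?thesis by (intro exI[of _ u] exI[of _ v]) auto
  qed
qed

section \<open>Explicit crooked functions\<close>

lemma lipschitz_on_glue:
  fixes f :: "real \<Rightarrow> real"
  assumes "L-lipschitz_on {a..b} f" "L-lipschitz_on {b..c} f"
  shows "L-lipschitz_on {a..c} f"
  using lipschitz_on_concat[OF assms refl] by simp

text \<open>Up to \<open>1 - \<eta>\<close>, down to \<open>\<eta>\<close>, up to 1, each leg a
  scaled copy of the previous stage. The gaps \<open>\<eta>\<close> tend to 0 but have a divergent
  sum, so the shrinking factors \<open>1 - \<eta>\<close> multiply to 0.\<close>

primrec zig :: "nat \<Rightarrow> real \<Rightarrow> real" where
  "zig 0 = (\<lambda>x. x)"
| "zig (Suc n) = (\<lambda>x. let \<eta> = 1 / (real n + 3) in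
     if x \<le> 1/3 then (1 - \<eta>) * zig n (3 * x)
     else if x \<le> 2/3 then (1 - \<eta>) - (1 - 2 * \<eta>) * zig n (3 * x - 1)
     else \<eta> + (1 - \<eta>) * zig n (3 * x - 2))"

declare zig.simps(2) [simp del]

lemma zig_0 [simp]: "zig n 0 = 0"
  by (induction n) (auto simp: zig.simps(2))

lemma zig_1 [simp]: "zig n 1 = 1"
  by (induction n) (auto simp: zig.simps(2) Let_def)

text \<open>The three legs get the common form
  \<open>\<beta> + \<alpha> * zig n (3 * x - s)\<close>, here with \<open>s = 0\<close>, so that one
  argument treats all of them, shared end points included.\<close>

lemma zig_left:
  "x \<le> 1/3 \<Longrightarrow> zig (Suc n) x = 0 + (1 - 1 / (real n + 3)) * zig n (3 * x)"
  by (simp add: zig.simps(2) Let_def)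

lemma zig_mid:
  assumes "1/3 \<le> x" "x \<le> 2/3"
  shows "zig (Suc n) x = (1 - 1 / (real n + 3)) + (- (1 - 2 / (real n + 3))) * zig n (3 * x - 1)"
proof (cases "x = 1/3")
  case True
  show ?thesis unfolding True by (simp add: zig.simps(2) Let_def)
next
  case False
  then show ?thesis using assms by (simp add: zig.simps(2) Let_def algebra_simps)
qed

lemma zig_right:
  assumes "2/3 \<le> x"
  shows "zig (Suc n) x = 1 / (real n + 3) + (1 - 1 / (real n + 3)) * zig n (3 * x - 2)"
proof (cases "x = 2/3")
  case True
  show ?thesis unfolding True by (simp add: zig.simps(2) Let_def)
next
  case False
  then show ?thesis using assms by (simp add: zig.simps(2) Let_def)
qed

lemma zig_lipschitz: "(3 ^ n)-lipschitz_on {0..1} (zig n)"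
proof (induction n)
  case 0
  then show ?case by (auto simp: lipschitz_on_def)
next
  case (Suc n)
  have piece: "(3 ^ Suc n)-lipschitz_on {a..b} (zig (Suc n))"
    if eq: "\<And>x. a \<le> x \<Longrightarrow> x \<le> b \<Longrightarrow> zig (Suc n) x = \<beta> + \<alpha> * zig n (3 * x - s)"
      and "\<bar>\<alpha>\<bar> \<le> 1" "0 \<le> 3 * a - s" "3 * b - s \<le> 1" for a b \<alpha> \<beta> s
  proof (rule lipschitz_onI)
    fix x y assume xy: "x \<in> {a..b}" "y \<in> {a..b}"
    have "dist (zig (Suc n) x) (zig (Suc n) y) = \<bar>\<alpha>\<bar> * dist (zig n (3 * x - s)) (zig n (3 * y - s))"
      using xy by (simp add: eq dist_real_def abs_mult[symmetric] algebra_simps)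
    also have "\<dots> \<le> 1 * (3 ^ n * dist (3 * x - s) (3 * y - s))"
      using that xy by (intro mult_mono lipschitz_onD[OF Suc.IH]) auto
    also have "dist (3 * x - s) (3 * y - s) = 3 * dist x y"
      by (auto simp: dist_real_def abs_if)
    finally show "dist (zig (Suc n) x) (zig (Suc n) y) \<le> 3 ^ Suc n * dist x y"
      by simp
  qed simp
  have "(3 ^ Suc n)-lipschitz_on {0..1/3} (zig (Suc n))"
    by (rule piece[where s = 0 and \<beta> = 0 and \<alpha> = "1 - 1 / (real n + 3)"]) (use zig_left in auto)
  moreover have "(3 ^ Suc n)-lipschitz_on {1/3..2/3} (zig (Suc n))"
    by (rule piece[where s = 1, OF zig_mid]) (auto simp: field_simps)
  moreover have "(3 ^ Suc n)-lipschitz_on {2/3..1} (zig (Suc n))"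
    by (rule piece[where s = 2, OF zig_right]) (auto simp: field_simps)
  ultimately show ?case by (meson lipschitz_on_glue)
qed

lemma zig_range:
  assumes "0 \<le> x" "x \<le> 1"
  shows "0 \<le> zig n x" "zig n x \<le> 1"
proof -
  have "0 \<le> zig n x \<and> zig n x \<le> 1" using assms
  proof (induction n arbitrary: x)
    case (Suc n)
    define \<eta> where "\<eta> = 1 / (real n + 3)"
    have \<eta>: "0 < \<eta>" "\<eta> \<le> 1/3" by (auto simp: \<eta>_def field_simps)
    have *: "0 \<le> \<alpha> * zig n t \<and> \<alpha> * zig n t \<le> \<alpha>" if "0 \<le> t" "t \<le> 1" "0 \<le> \<alpha>" for \<alpha> t
      using Suc.IH[of t] that by (simp add: mult_left_le)
    consider "x \<le> 1/3" | "1/3 \<le> x" "x \<le> 2/3" | "2/3 \<le> x" by linarith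
    then show ?case
    proof cases
      case 1
      show ?thesis using *[of "3 * x" "1 - \<eta>"] 1 Suc.prems \<eta> unfolding zig_left[OF 1] \<eta>_def[symmetric]
        by linarith
    next
      case 2
      have \<eta>2: "2 / (real n + 3) = 2 * \<eta>" by (simp add: \<eta>_def)
      show ?thesis using *[of "3 * x - 1" "1 - 2 * \<eta>"] 2 Suc.prems \<eta>
        unfolding zig_mid[OF 2] \<eta>_def[symmetric] \<eta>2 minus_mult_left[symmetric] by linarith
    next
      case 3
      show ?thesis using *[of "3 * x - 2" "1 - \<eta>"] 3 Suc.prems \<eta> unfolding zig_right[OF 3] \<eta>_def[symmetric]
        by linarith
    qed
  qed simp
  then show "0 \<le> zig n x" "zig n x \<le> 1" by auto
qed

text \<open>Each leg is the previous stage scaled by at most \<open>1 - \<eta>\<close>, and the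
  outer legs exceed the turning points by at most \<open>\<eta>\<close>, so the zigzag criterion
  applies with error \<open>2 * \<eta>\<close>.\<close>

lemma zig_crooked: "crooked_on (2 / (real n + 2)) (zig n) 0 1"
proof (induction n)
  case 0
  \<comment> \<open>The error is 1 here, the whole height of the path.\<close>
  show ?case unfolding crooked_on_def
  proof (intro allI impI, elim conjE)
    fix c d :: real assume "0 \<le> c" "c \<le> d" "d \<le> 1"
    then show "\<exists>u v. c \<le> u \<and> u \<le> v \<and> v \<le> d \<and> \<bar>zig 0 u - zig 0 d\<bar> \<le> 2 / (real 0 + 2) \<and>
        \<bar>zig 0 v - zig 0 c\<bar> \<le> 2 / (real 0 + 2)"
      by (intro exI[of _ c] exI[of _ d]) auto
  qed
next
  case (Suc n)
  define \<eta> where "\<eta> = 1 / (real n + 3)"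
  have \<eta>: "0 < \<eta>" "\<eta> \<le> 1/3" by (auto simp: \<eta>_def field_simps)
  have \<eta>2: "2 / (real n + 3) = 2 * \<eta>" by (simp add: \<eta>_def)
  \<comment> \<open>This explains the choice of \<open>\<eta>\<close>: the inherited error shrinks
    exactly to the one claimed for the next stage.\<close>
  have tol: "(1 - \<eta>) * (2 / (real n + 2)) = 2 * \<eta>"
    by (simp add: \<eta>_def divide_simps)
  have piece: "crooked_on (2 * \<eta>) (zig (Suc n)) a b"
    if eq: "\<And>x. a \<le> x \<Longrightarrow> x \<le> b \<Longrightarrow> zig (Suc n) x = \<beta> + \<alpha> * zig n (3 * x - s)"
      and \<alpha>: "\<bar>\<alpha>\<bar> \<le> 1 - \<eta>" and "0 \<le> 3 * a - s" "3 * b - s \<le> 1" for a b \<alpha> \<beta> s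
  proof (rule crooked_on_dominated)
    show "crooked_on (2 / (real n + 2)) (\<lambda>t. zig n (3 * t - s)) a b"
      by (rule crooked_on_compose[OF Suc.IH]) (use that in \<open>auto intro!: continuous_intros mono_onI\<close>)
    show "(1 - \<eta>) * (2 / (real n + 2)) \<le> 2 * \<eta>" using tol by linarith
    fix u v assume "a \<le> u" "u \<le> b" "a \<le> v" "v \<le> b"
    then have "\<bar>zig (Suc n) u - zig (Suc n) v\<bar> = \<bar>\<alpha>\<bar> * \<bar>zig n (3 * u - s) - zig n (3 * v - s)\<bar>"
      by (simp add: eq abs_mult[symmetric] algebra_simps)
    also have "\<dots> \<le> (1 - \<eta>) * \<bar>zig n (3 * u - s) - zig n (3 * v - s)\<bar>"
      using \<alpha> by (intro mult_right_mono) auto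
    finally show "\<bar>zig (Suc n) u - zig (Suc n) v\<bar> \<le> (1 - \<eta>) * \<bar>zig n (3 * u - s) - zig n (3 * v - s)\<bar>" .
  qed (use \<eta> in simp)
  have scaled: "0 \<le> \<alpha> * zig n t \<and> \<alpha> * zig n t \<le> \<alpha>" if "0 \<le> t" "t \<le> 1" "0 \<le> \<alpha>" for \<alpha> t
    using zig_range[of t n] that by (simp add: mult_left_le)
  note left = zig_left[of _ n, folded \<eta>_def]
    and mid = zig_mid[of _ n, folded \<eta>_def, unfolded \<eta>2]
    and right = zig_right[of _ n, folded \<eta>_def]
  have peak: "zig (Suc n) (1/3) = 1 - \<eta>" and valley: "zig (Suc n) (2/3) = \<eta>"
    using left[of "1/3"] right[of "2/3"] by auto
  have "crooked_on (2 * \<eta>) (zig (Suc n)) 0 1"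
  proof (rule crooked_on_zigzag[where l = "1/3" and r = "2/3"])
    show "crooked_on (2 * \<eta>) (zig (Suc n)) 0 (1/3)"
      by (rule piece[where s = 0 and \<beta> = 0 and \<alpha> = "1 - \<eta>"]) (use left \<eta> in auto)
    show "crooked_on (2 * \<eta>) (zig (Suc n)) (1/3) (2/3)"
      by (rule piece[where s = 1, OF mid]) (use \<eta> in auto)
    show "crooked_on (2 * \<eta>) (zig (Suc n)) (2/3) 1"
      by (rule piece[where s = 2, OF right]) (use \<eta> in auto)
    show "continuous_on {0..1} (zig (Suc n))"
      using zig_lipschitz lipschitz_on_continuous_on by blast
    show "zig (Suc n) t \<le> zig (Suc n) (1/3)" if "0 \<le> t" "t \<le> 2/3" for t
    proof (cases "t \<le> 1/3")
      case True
      then show ?thesis using left[of t] scaled[of "3 * t" "1 - \<eta>"] that \<eta> peak by linarith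
    next
      case False
      then show ?thesis using mid[of t, unfolded minus_mult_left[symmetric]] scaled[of "3 * t - 1" "1 - 2 * \<eta>"] that \<eta> peak by linarith
    qed
    show "zig (Suc n) (2/3) \<le> zig (Suc n) t" if "1/3 \<le> t" "t \<le> 1" for t
    proof (cases "t \<le> 2/3")
      case True
      then show ?thesis using mid[of t, unfolded minus_mult_left[symmetric]] scaled[of "3 * t - 1" "1 - 2 * \<eta>"] that \<eta> valley by linarith
    next
      case False
      then show ?thesis using right[of t] scaled[of "3 * t - 2" "1 - \<eta>"] that \<eta> valley by linarith
    qed
    show "zig (Suc n) t \<le> zig (Suc n) (1/3) + 2 * \<eta>" if "2/3 \<le> t" "t \<le> 1" for t
      using zig_range(2)[of t "Suc n"] that \<eta> peak by auto
    show "zig (Suc n) (2/3) - 2 * \<eta> \<le> zig (Suc n) t" if "0 \<le> t" "t \<le> 1/3" for t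
      using zig_range(1)[of t "Suc n"] that \<eta> valley by auto
  qed (use \<eta> in auto)
  moreover have "2 * \<eta> = 2 / (real (Suc n) + 2)" by (simp add: \<eta>_def)
  ultimately show ?case by simp
qed

text \<open>This shows that \<open>zig\<close> has no plateaus of its own. A level set is covered by
  affine images of three level sets of the previous stage at other values, hence the induction over
  all \<open>v\<close>.\<close>

lemma finite_zig_level: "finite {x. 0 \<le> x \<and> x \<le> 1 \<and> zig n x = v}"
proof (induction n arbitrary: v)
  case 0
  have "{x. 0 \<le> x \<and> x \<le> 1 \<and> zig 0 x = v} \<subseteq> {v}" by auto
  then show ?case by (rule finite_subset) simp
next
  case (Suc n)
  define Z where "Z v = {x. 0 \<le> x \<and> x \<le> 1 \<and> zig n x = v}" for v
  define \<eta> where "\<eta> = 1 / (real n + 3)"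
  have \<eta>: "0 < \<eta>" "\<eta> \<le> 1/3" by (auto simp: \<eta>_def field_simps)
  have \<eta>2: "2 / (real n + 3) = 2 * \<eta>" by (simp add: \<eta>_def)
  have "x \<in> (\<lambda>x. x / 3) ` Z (v / (1 - \<eta>)) \<union> (\<lambda>x. (x + 1) / 3) ` Z ((1 - \<eta> - v) / (1 - 2 * \<eta>))
           \<union> (\<lambda>x. (x + 2) / 3) ` Z ((v - \<eta>) / (1 - \<eta>))"
    if x: "0 \<le> x" "x \<le> 1" "zig (Suc n) x = v" for x
  proof -
    consider "x \<le> 1/3" | "1/3 \<le> x" "x \<le> 2/3" | "2/3 \<le> x" by linarith
    then show ?thesis
    proof cases
      case 1
      have "3 * x \<in> Z (v / (1 - \<eta>))"
        using x 1 \<eta> zig_left[OF 1, of n, folded \<eta>_def] by (simp add: Z_def field_simps)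
      then have "3 * x / 3 \<in> (\<lambda>x. x / 3) ` Z (v / (1 - \<eta>))" by (rule imageI)
      then show ?thesis by simp
    next
      case 2
      have "3 * x - 1 \<in> Z ((1 - \<eta> - v) / (1 - 2 * \<eta>))"
        using x 2 \<eta> zig_mid[OF 2, of n, folded \<eta>_def, unfolded \<eta>2] by (simp add: Z_def field_simps)
      then have "(3 * x - 1 + 1) / 3 \<in> (\<lambda>x. (x + 1) / 3) ` Z ((1 - \<eta> - v) / (1 - 2 * \<eta>))"
        by (rule imageI)
      then show ?thesis by simp
    next
      case 3
      have "3 * x - 2 \<in> Z ((v - \<eta>) / (1 - \<eta>))"
        using x 3 \<eta> zig_right[OF 3, of n, folded \<eta>_def] by (simp add: Z_def field_simps)
      then have "(3 * x - 2 + 2) / 3 \<in> (\<lambda>x. (x + 2) / 3) ` Z ((v - \<eta>) / (1 - \<eta>))"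
        by (rule imageI)
      then show ?thesis by simp
    qed
  qed
  then have "{x. 0 \<le> x \<and> x \<le> 1 \<and> zig (Suc n) x = v} \<subseteq>
      (\<lambda>x. x / 3) ` Z (v / (1 - \<eta>)) \<union> (\<lambda>x. (x + 1) / 3) ` Z ((1 - \<eta> - v) / (1 - 2 * \<eta>))
           \<union> (\<lambda>x. (x + 2) / 3) ` Z ((v - \<eta>) / (1 - \<eta>))"
    by blast
  moreover have "finite (Z w)" for w unfolding Z_def by (rule Suc.IH)
  ultimately show ?case by (auto elim: finite_subset)
qed


section \<open>The zigzag map on the half line\<close>

text \<open>
  \<open>lip_bound i\<close> is a Lipschitz constant of the map on \<open>[0, i]\<close>, and \<open>zig (depth i)\<close> is used on
  \<open>[i, i + 1]\<close>; the exponent in \<open>lip_bound (Suc i)\<close> is \<open>depth i\<close>. The factor 10 exceeds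
  \<open>7 * 4 / 3\<close>, where 7 bounds the height of a lap and 4/3 is the slope of \<open>pause\<close>.
\<close>

primrec lip_bound :: "nat \<Rightarrow> nat" where
  "lip_bound 0 = 1"
| "lip_bound (Suc i) = lip_bound i + 10 * 3 ^ (14 * Suc i * lip_bound i ^ i)"

definition depth :: "nat \<Rightarrow> nat" where
  "depth i = 14 * Suc i * lip_bound i ^ i"

text \<open>Values before clipping at 0, negative for small \<open>i\<close>. Rising laps gain 7 and
  falling laps lose 5.\<close>

definition vertex :: "nat \<Rightarrow> real" where
  "vertex i = real i - (if even i then 8 else 2)"

text \<open>For \<open>i \<in> P\<close> the path waits on the first quarter of the lap and then
  runs at speed 4/3. As 0 and 1 are fixed, the vertices keep their values.\<close>

definition pause :: "nat set \<Rightarrow> nat \<Rightarrow> real \<Rightarrow> real" where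
  "pause P i t = (if i \<in> P then max 0 ((4 * t - 1) / 3) else t)"

definition lap :: "nat set \<Rightarrow> nat \<Rightarrow> real \<Rightarrow> real" where
  "lap P i x = vertex i + (vertex (Suc i) - vertex i) * zig (depth i) (pause P i (x - real i))"

definition zmap :: "nat set \<Rightarrow> real \<Rightarrow> real" where
  "zmap P x = max 0 (lap P (nat \<lfloor>x\<rfloor>) x)"

section \<open>Range, displacement and expansion of the map\<close>

lemma lip_bound_pos: "1 \<le> lip_bound i"
  by (induction i) auto

lemma pause_range: "0 \<le> t \<Longrightarrow> t \<le> 1 \<Longrightarrow> 0 \<le> pause P i t \<and> pause P i t \<le> 1"
  by (auto simp: pause_def)

lemma pause_lipschitz: "\<bar>pause P i s - pause P i t\<bar> \<le> 4/3 * \<bar>s - t\<bar>"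
  by (auto simp: pause_def max_def abs_if field_simps)

lemma pause_mono: "s \<le> t \<Longrightarrow> pause P i s \<le> pause P i t"
  by (auto simp: pause_def max_def)

lemma continuous_on_pause: "continuous_on A (pause P i)"
  by (cases "i \<in> P") (auto simp: pause_def intro!: continuous_intros)

lemma lap_range:
  assumes "real i \<le> x" "x \<le> real i + 1"
  shows "even i \<Longrightarrow> real i - 8 \<le> lap P i x \<and> lap P i x \<le> real i - 1"
    and "odd i \<Longrightarrow> real i - 7 \<le> lap P i x \<and> lap P i x \<le> real i - 2"
proof -
  have "0 \<le> zig (depth i) (pause P i (x - real i))" "zig (depth i) (pause P i (x - real i)) \<le> 1"
    using pause_range[of "x - real i" P i] assms by (auto intro!: zig_range)
  then show "even i \<Longrightarrow> real i - 8 \<le> lap P i x \<and> lap P i x \<le> real i - 1"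
    and "odd i \<Longrightarrow> real i - 7 \<le> lap P i x \<and> lap P i x \<le> real i - 2"
    by (auto simp: lap_def vertex_def)
qed

text \<open>At the right end the floor selects the next lap, but both laps take the vertex value
  there.\<close>

lemma zmap_lap:
  assumes "real i \<le> x" "x \<le> real i + 1"
  shows "zmap P x = max 0 (lap P i x)"
proof (cases "x = real i + 1")
  case True
  then have "nat \<lfloor>x\<rfloor> = Suc i" by linarith
  then show ?thesis using True by (simp add: zmap_def lap_def pause_def)
next
  case False
  then have "nat \<lfloor>x\<rfloor> = i" using assms by linarith
  then show ?thesis by (simp add: zmap_def)
qed

lemma zmap_nat: "zmap P (real i) = max 0 (vertex i)"
  by (simp add: zmap_lap[of i] lap_def pause_def)

lemma zmap_even_lap:
  assumes "even i" "real i \<le> x" "x \<le> real i + 1"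
  shows "max 0 (real i - 8) \<le> zmap P x" "zmap P x \<le> max 0 (real i - 1)"
  using lap_range(1)[OF assms(2,3,1), of P] by (auto simp: zmap_lap[OF assms(2,3)])

lemma zmap_odd_lap:
  assumes "odd i" "real i \<le> x" "x \<le> real i + 1"
  shows "max 0 (real i - 7) \<le> zmap P x" "zmap P x \<le> max 0 (real i - 2)"
  using lap_range(2)[OF assms(2,3,1), of P] by (auto simp: zmap_lap[OF assms(2,3)])

lemma real_in_lap:
  fixes x :: real assumes "0 \<le> x"
  obtains i where "real i \<le> x" "x < real i + 1"
  by (rule that[of "nat \<lfloor>x\<rfloor>"]) (use assms in linarith)+

lemma zmap_nonneg: "0 \<le> zmap P x"
  by (simp add: zmap_def)

lemma zmap_le:
  assumes "0 \<le> x"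
  shows "zmap P x \<le> max 0 (x - 1)"
proof -
  obtain i where i: "real i \<le> x" "x < real i + 1" using real_in_lap[OF assms] .
  then show ?thesis using zmap_even_lap(2)[of i x P] zmap_odd_lap(2)[of i x P] by force
qed

text \<open>The bounded displacement later gives continuity at 1. A point below \<open>i + 1\<close>
  is sent no lower than \<open>i - 8\<close>, whence 9.\<close>

lemma zmap_ge:
  assumes "0 \<le> x"
  shows "x - 9 \<le> zmap P x"
proof -
  obtain i where i: "real i \<le> x" "x < real i + 1" using real_in_lap[OF assms] .
  then show ?thesis using zmap_even_lap(1)[of i x P] zmap_odd_lap(1)[of i x P] by force
qed

text \<open>
  Strictness forces the first integer inside \<open>[x, y]\<close> to be a peak (odd) and the last one to be a
  valley (even).
\<close>

lemma zmap_expanding_up: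
  assumes xy: "0 \<le> x" "x < y"
    and strict: "\<And>t. x < t \<Longrightarrow> t < y \<Longrightarrow> zmap P x < zmap P t \<and> zmap P t < zmap P y"
  shows "(\<exists>i. real i \<le> x \<and> y \<le> real i + 1) \<or> y - x + 2 \<le> zmap P y - zmap P x"
proof -
  obtain l where l: "real l \<le> x" "x < real l + 1" using real_in_lap[OF xy(1)] .
  show ?thesis
  proof (cases "y \<le> real l + 1")
    case True
    then show ?thesis using l by blast
  next
    case False
    \<comment> \<open>\<open>M\<close> is the last integer strictly below \<open>y\<close>.\<close>
    define M where "M = nat (\<lceil>y\<rceil> - 1)"
    have M: "real M < y" "y \<le> real M + 1" and lM: "Suc l \<le> M"
      using False unfolding M_def by linarith+
    have "even l"
    proof (rule ccontr)
      assume "odd l"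
      then show False
        using strict[of "real (Suc l)"] zmap_odd_lap(1)[of l x P] zmap_nat[of P "Suc l"] l False
        by (auto simp: vertex_def)
    qed
    have "even M"
    proof (rule ccontr)
      assume "odd M"
      then show False
        using strict[of "real M"] zmap_odd_lap(2)[of M y P] zmap_nat[of P M] M lM l
        by (auto simp: vertex_def)
    qed
    have lM': "Suc (Suc l) \<le> M" using \<open>even l\<close> \<open>even M\<close> lM by (metis Suc_leI even_Suc le_neq_implies_less)
    \<comment> \<open>The peak \<open>M - 1\<close> and the valley \<open>l + 2\<close> lie inside.
      The first puts the value at \<open>y\<close> above \<open>M - 3\<close>, the second puts the
      value at \<open>x\<close> below \<open>l - 6\<close>. So the gain exceeds
      \<open>M - l + 3\<close>, while \<open>y - x \<le> M + 1 - l\<close>.\<close>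
    have "real M = real (M - 1) + 1" "odd (M - 1)" using lM \<open>even M\<close> by auto
    then have "real M - 3 < zmap P y"
      using strict[of "real (M - 1)"] zmap_nat[of P "M - 1"] M lM' l by (auto simp: vertex_def)
    moreover have "zmap P x < real l - 6"
      using strict[of "real (Suc (Suc l))"] zmap_nat[of P "Suc (Suc l)"] zmap_nonneg[of P x] M lM' l \<open>even l\<close>
      by (auto simp: vertex_def)
    ultimately show ?thesis using l M by linarith
  qed
qed

text \<open>A strict descent across an integer would have a valley as its first integer and a peak
  as its last. Peaks never fall to the right, so this last peak would be at least as high as the
  start.\<close>

lemma zmap_expanding_down:
  assumes xy: "0 \<le> x" "x < y"
    and strict: "\<And>t. x < t \<Longrightarrow> t < y \<Longrightarrow> zmap P y < zmap P t \<and> zmap P t < zmap P x"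
  shows "\<exists>i. real i \<le> x \<and> y \<le> real i + 1"
proof -
  obtain l where l: "real l \<le> x" "x < real l + 1" using real_in_lap[OF xy(1)] .
  have "y \<le> real l + 1"
  proof (rule ccontr)
    assume False: "\<not> y \<le> real l + 1"
    define M where "M = nat (\<lceil>y\<rceil> - 1)"
    have M: "real M < y" "y \<le> real M + 1" and lM: "Suc l \<le> M"
      using False unfolding M_def by linarith+
    have "odd l"
    proof (rule ccontr)
      assume "\<not> odd l"
      then show False
        using strict[of "real (Suc l)"] zmap_even_lap(2)[of l x P] zmap_nat[of P "Suc l"] l False
        by (simp add: vertex_def)
    qed
    have "odd M"
    proof (rule ccontr)
      assume "\<not> odd M"
      then show False
        using strict[of "real M"] zmap_even_lap(1)[of M y P] zmap_nat[of P M] M lM l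
        by (auto simp: vertex_def)
    qed
    show False
      using strict[of "real M"] zmap_odd_lap(2)[of l x P] zmap_nat[of P M] M lM l \<open>odd l\<close> \<open>odd M\<close>
      by (auto simp: vertex_def)
  qed
  then show ?thesis using l by blast
qed

section \<open>Lipschitz constants of the iterates\<close>

lemma lap_lipschitz:
  assumes "real i \<le> x" "x \<le> real i + 1" "real i \<le> y" "y \<le> real i + 1"
  shows "\<bar>zmap P x - zmap P y\<bar> \<le> 7 * \<bar>zig (depth i) (pause P i (x - i)) - zig (depth i) (pause P i (y - i))\<bar>"
proof -
  have "\<bar>zmap P x - zmap P y\<bar> \<le> \<bar>lap P i x - lap P i y\<bar>"
    using assms by (simp add: zmap_lap)
  also have "\<dots> = \<bar>vertex (Suc i) - vertex i\<bar> * \<bar>zig (depth i) (pause P i (x - i)) - zig (depth i) (pause P i (y - i))\<bar>"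
    by (simp add: lap_def abs_mult[symmetric] algebra_simps)
  also have "\<dots> \<le> 7 * \<bar>zig (depth i) (pause P i (x - i)) - zig (depth i) (pause P i (y - i))\<bar>"
    by (rule mult_right_mono) (auto simp: vertex_def)
  finally show ?thesis .
qed

lemma zmap_lipschitz: "(real (lip_bound i))-lipschitz_on {0..real i} (zmap P)"
proof (induction i)
  case (Suc i)
  have "(real (lip_bound (Suc i)))-lipschitz_on {0..real i} (zmap P)"
    by (rule lipschitz_on_le[OF Suc.IH]) simp
  moreover have "(real (lip_bound (Suc i)))-lipschitz_on {real i..real (Suc i)} (zmap P)"
  proof (rule lipschitz_onI)
    fix x y assume xy: "x \<in> {real i..real (Suc i)}" "y \<in> {real i..real (Suc i)}"
    have pr: "pause P i (x - i) \<in> {0..1}" "pause P i (y - i) \<in> {0..1}"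
      using xy by (auto simp: pause_range)
    have "\<bar>zmap P x - zmap P y\<bar> \<le> 7 * \<bar>zig (depth i) (pause P i (x - i)) - zig (depth i) (pause P i (y - i))\<bar>"
      using xy by (intro lap_lipschitz) auto
    also have "\<dots> \<le> 7 * (3 ^ depth i * \<bar>pause P i (x - i) - pause P i (y - i)\<bar>)"
      using lipschitz_onD[OF zig_lipschitz pr] by (simp add: dist_real_def)
    also have "\<dots> \<le> 7 * (3 ^ depth i * (4/3 * \<bar>(x - i) - (y - i)\<bar>))"
      by (intro mult_left_mono pause_lipschitz) auto
    also have "\<dots> = 28/3 * 3 ^ depth i * \<bar>x - y\<bar>" by simp
    also have "\<dots> \<le> real (lip_bound (Suc i)) * \<bar>x - y\<bar>"
    proof (rule mult_right_mono)
      have "28/3 * 3 ^ depth i \<le> 10 * (3::real) ^ depth i" by simp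
      also have "\<dots> \<le> real (lip_bound (Suc i))" by (simp add: depth_def)
      finally show "28/3 * 3 ^ depth i \<le> real (lip_bound (Suc i))" .
    qed simp
    finally show "dist (zmap P x) (zmap P y) \<le> real (lip_bound (Suc i)) * dist x y"
      by (simp add: dist_real_def)
  qed simp
  ultimately show ?case by (rule lipschitz_on_glue)
qed (auto simp: lipschitz_on_def)

lemma zmap_iterate_nonneg: "0 \<le> x \<Longrightarrow> 0 \<le> (zmap P ^^ n) x"
  by (induction n) (auto simp: zmap_nonneg)

lemma zmap_iterate_le: "0 \<le> x \<Longrightarrow> (zmap P ^^ n) x \<le> max 0 (x - real n)"
proof (induction n)
  case (Suc n)
  have "zmap P ((zmap P ^^ n) x) \<le> max 0 ((zmap P ^^ n) x - 1)"
    by (rule zmap_le[OF zmap_iterate_nonneg[OF Suc.prems]])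
  then show ?case using Suc by auto
qed simp

text \<open>No iterate leaves \<open>[0, i]\<close>, so the constant of one application is raised to
  the power \<open>n\<close>.\<close>

lemma zmap_iterate_lipschitz:
  "(real (lip_bound i) ^ n)-lipschitz_on {0..real i} (zmap P ^^ n)"
proof (induction n)
  case 0
  then show ?case by (auto simp: lipschitz_on_def)
next
  case (Suc n)
  have "(zmap P ^^ n) ` {0..real i} \<subseteq> {0..real i}"
    using zmap_iterate_le[of _ n P] zmap_iterate_nonneg[of _ n P] by fastforce
  then have "(real (lip_bound i))-lipschitz_on ((zmap P ^^ n) ` {0..real i}) (zmap P)"
    by (rule lipschitz_on_subset[OF zmap_lipschitz])
  from lipschitz_on_compose[OF Suc.IH this] show ?case by (simp add: o_def)
qed

lemma continuous_on_zmap_iterate: "0 \<le> c \<Longrightarrow> continuous_on {c..d} (zmap P ^^ n)"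
proof -
  assume "0 \<le> c"
  obtain i where "d \<le> real i" using real_arch_simple by blast
  then show ?thesis
    using continuous_on_subset[OF lipschitz_on_continuous_on[OF zmap_iterate_lipschitz[where i = i and n = n and P = P]]] \<open>0 \<le> c\<close>
    by auto
qed

lemma continuous_on_zmap: "0 \<le> c \<Longrightarrow> continuous_on {c..d} (zmap P)"
  using continuous_on_zmap_iterate[of c d 1 P] by simp

text \<open>The first application follows \<open>zig (depth i)\<close> with factor at most 7 and
  lands in \<open>[0, i]\<close>; the other \<open>j \<le> i\<close> stretch distances there by at
  most \<open>lip_bound i ^ j\<close>. The 14 in \<open>depth\<close> is 7 times the 2 in the error
  of \<open>zig\<close>, and its power of \<open>lip_bound i\<close> absorbs the stretching.\<close>

lemma lap_iterate_crooked:
  assumes "j \<le> i"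
  shows "crooked_on (1 / (real i + 1)) (zmap P ^^ Suc j) (real i) (real i + 1)"
proof (rule crooked_on_dominated)
  show "crooked_on (2 / (real (depth i) + 2)) (\<lambda>t. zig (depth i) (pause P i (t - i))) (real i) (real i + 1)"
  proof (rule crooked_on_compose[OF zig_crooked])
    show "continuous_on {real i..real i + 1} (\<lambda>t. pause P i (t - i))"
      by (rule continuous_on_compose2[OF continuous_on_pause[of UNIV]]) (auto intro!: continuous_intros)
  qed (auto intro!: mono_onI pause_mono simp: pause_range)
  have "1 * real (lip_bound i) ^ j \<le> real (lip_bound i) ^ i"
    using assms lip_bound_pos[of i] by (simp add: power_increasing)
  then have "14 * (real i + 1) * real (lip_bound i) ^ j \<le> real (depth i) + 2"
    by (simp add: depth_def algebra_simps)
       (smt (verit) mult_left_mono of_nat_0_le_iff)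
  then show "7 * real (lip_bound i) ^ j * (2 / (real (depth i) + 2)) \<le> 1 / (real i + 1)"
    by (simp add: field_simps)
  fix s t assume st: "real i \<le> s" "s \<le> real i + 1" "real i \<le> t" "t \<le> real i + 1"
  have "zmap P s \<in> {0..real i}" "zmap P t \<in> {0..real i}"
    using st zmap_le[of s P] zmap_le[of t P] by (auto simp: zmap_nonneg)
  then have "\<bar>(zmap P ^^ j) (zmap P s) - (zmap P ^^ j) (zmap P t)\<bar> \<le> real (lip_bound i) ^ j * \<bar>zmap P s - zmap P t\<bar>"
    using lipschitz_onD[OF zmap_iterate_lipschitz[where i = i and n = j and P = P]] by (simp add: dist_real_def)
  also have "\<dots> \<le> real (lip_bound i) ^ j * (7 * \<bar>zig (depth i) (pause P i (s - i)) - zig (depth i) (pause P i (t - i))\<bar>)"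
    using st by (intro mult_left_mono lap_lipschitz) auto
  finally show "\<bar>(zmap P ^^ Suc j) s - (zmap P ^^ Suc j) t\<bar> \<le>
      7 * real (lip_bound i) ^ j * \<bar>zig (depth i) (pause P i (s - i)) - zig (depth i) (pause P i (t - i))\<bar>"
    by (simp add: funpow_swap1 mult_ac)
qed simp

section \<open>Pulling values back through the iterates\<close>

lemma strict_crossing_up:
  fixes f :: "real \<Rightarrow> real"
  assumes cont: "continuous_on {a..b} f" and ab: "a \<le> b" "f a < f b"
  obtains a' b' where "a \<le> a'" "a' < b'" "b' \<le> b" "f a' = f a" "f b' = f b"
    "\<And>t. a' < t \<Longrightarrow> t < b' \<Longrightarrow> f a < f t \<and> f t < f b"
proof -
  have cont': "continuous_on {s..t} f" if "a \<le> s" "t \<le> b" for s t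
    using continuous_on_subset[OF cont] that by simp
  have level: "compact {t \<in> {s..u}. f t = v}" if "a \<le> s" "u \<le> b" for s u v
    unfolding compact_eq_bounded_closed
    using continuous_closed_preimage_constant[OF cont'[OF that], of v]
    by (auto intro: bounded_subset[OF bounded_closed_interval])
  \<comment> \<open>\<open>b'\<close> is the first point with the final value, and \<open>a'\<close>
    the last point before it with the initial value.\<close>
  obtain b' where b': "b' \<in> {a..b}" "f b' = f b" and min: "\<And>t. a \<le> t \<Longrightarrow> t \<le> b \<Longrightarrow> f t = f b \<Longrightarrow> b' \<le> t"
    using compact_attains_inf[OF level[of a b "f b"]] ab by auto
  obtain a' where a': "a' \<in> {a..b'}" "f a' = f a" and max: "\<And>t. a \<le> t \<Longrightarrow> t \<le> b' \<Longrightarrow> f t = f a \<Longrightarrow> t \<le> a'"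
    using compact_attains_sup[OF level[of a b' "f a"]] b' by auto
  have "a' \<noteq> b'" using a' b' ab by auto
  show ?thesis
  proof (rule that[of a' b'])
    fix t assume t: "a' < t" "t < b'"
    show "f a < f t \<and> f t < f b"
    proof (intro conjI; rule ccontr)
      assume "\<not> f a < f t"
      then obtain s where "t \<le> s" "s \<le> b'" "f s = f a"
        using IVT'[of f t "f a" b'] cont'[of t b'] t a' b' ab by auto
      then show False using max[of s] t a' by auto
    next
      assume "\<not> f t < f b"
      then obtain s where "a \<le> s" "s \<le> t" "f s = f b"
        using IVT'[of f a "f b" t] cont'[of a t] t a' b' ab by auto
      then show False using min[of s] t b' by auto
    qed
  qed (use a' b' \<open>a' \<noteq> b'\<close> in auto)
qed

lemma strict_crossing_down:
  fixes f :: "real \<Rightarrow> real"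
  assumes cont: "continuous_on {a..b} f" and ab: "a \<le> b" "f b < f a"
  obtains a' b' where "a \<le> a'" "a' < b'" "b' \<le> b" "f a' = f a" "f b' = f b"
    "\<And>t. a' < t \<Longrightarrow> t < b' \<Longrightarrow> f b < f t \<and> f t < f a"
proof -
  obtain a' b' where "a \<le> a'" "a' < b'" "b' \<le> b" "- f a' = - f a" "- f b' = - f b"
    and "\<And>t. a' < t \<Longrightarrow> t < b' \<Longrightarrow> - f a < - f t \<and> - f t < - f b"
    using strict_crossing_up[of a b "\<lambda>t. - f t"] ab continuous_on_minus[OF cont] by auto
  then show ?thesis using that[of a' b'] by auto
qed

text \<open>One pull-back step: the interval shrinks to a strict one with the same end values, to
  which the expansion lemmas apply. For equal end values a single point does.\<close>

lemma zmap_crossing: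
  assumes pq: "0 \<le> p" "p \<le> q"
  obtains p' q' where "p \<le> p'" "p' \<le> q'" "q' \<le> q" "zmap P p' = zmap P p" "zmap P q' = zmap P q"
    "(\<exists>i. real i \<le> p' \<and> q' \<le> real i + 1) \<or> q' - p' + 2 \<le> \<bar>zmap P p - zmap P q\<bar>"
proof -
  consider "zmap P p = zmap P q" | "zmap P p < zmap P q" | "zmap P q < zmap P p" by linarith
  then show ?thesis
  proof cases
    case 1
    obtain i where "real i \<le> p" "p < real i + 1" using real_in_lap[OF pq(1)] .
    then show ?thesis using 1 pq by (intro that[of p p]) auto
  next
    case 2
    obtain p' q' where *: "p \<le> p'" "p' < q'" "q' \<le> q" "zmap P p' = zmap P p" "zmap P q' = zmap P q"
      "\<And>t. p' < t \<Longrightarrow> t < q' \<Longrightarrow> zmap P p < zmap P t \<and> zmap P t < zmap P q"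
      using strict_crossing_up[OF continuous_on_zmap[OF pq(1)] pq(2) 2] by blast
    then have "(\<exists>i. real i \<le> p' \<and> q' \<le> real i + 1) \<or> q' - p' + 2 \<le> zmap P q' - zmap P p'"
      using pq by (intro zmap_expanding_up) auto
    then show ?thesis using that[of p' q'] * 2 by auto
  next
    case 3
    obtain p' q' where *: "p \<le> p'" "p' < q'" "q' \<le> q" "zmap P p' = zmap P p" "zmap P q' = zmap P q"
      "\<And>t. p' < t \<Longrightarrow> t < q' \<Longrightarrow> zmap P q < zmap P t \<and> zmap P t < zmap P p"
      using strict_crossing_down[OF continuous_on_zmap[OF pq(1)] pq(2) 3] by blast
    then have "\<exists>i. real i \<le> p' \<and> q' \<le> real i + 1"
      using pq by (intro zmap_expanding_down[where P = P]) auto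
    then show ?thesis using that[of p' q'] * by auto
  qed
qed

text \<open>Each application costs 2 of the allowed distance, hence the bound
  \<open>2 * (k + 1)\<close> for \<open>k + 1\<close> applications. The case
  \<open>d' \<le> c'\<close> is already the reversal that crookedness asks for.\<close>

lemma zmap_iterate_crossing:
  assumes "0 \<le> c" "c \<le> d" "\<bar>(zmap P ^^ Suc k) c - (zmap P ^^ Suc k) d\<bar> \<le> 2 * (real k + 1)"
  shows "\<exists>c' d'. c \<le> c' \<and> c' \<le> d \<and> c \<le> d' \<and> d' \<le> d \<and>
    (zmap P ^^ Suc k) c' = (zmap P ^^ Suc k) c \<and> (zmap P ^^ Suc k) d' = (zmap P ^^ Suc k) d \<and>
    (d' \<le> c' \<or> (\<exists>i. real i \<le> c' \<and> d' \<le> real i + 1))"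
  using assms
proof (induction k arbitrary: c d)
  case 0
  \<comment> \<open>A difference of at most 2 leaves no length in the expanding case, so
    \<open>q \<le> p\<close>.\<close>
  obtain p q where "c \<le> p" "p \<le> q" "q \<le> d" "zmap P p = zmap P c" "zmap P q = zmap P d"
    "(\<exists>i. real i \<le> p \<and> q \<le> real i + 1) \<or> q - p + 2 \<le> \<bar>zmap P c - zmap P d\<bar>"
    by (rule zmap_crossing[OF 0(1,2)])
  then show ?case using 0 by (intro exI[of _ p] exI[of _ q]) auto
next
  case (Suc k)
  define G where "G = zmap P ^^ Suc k"
  have G: "(zmap P ^^ Suc (Suc k)) x = zmap P (G x)" for x by (simp add: G_def)
  have Gpos: "0 \<le> G x" if "0 \<le> x" for x unfolding G_def using that by (rule zmap_iterate_nonneg)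
  have cont: "continuous_on {s..t} G" if "0 \<le> s" for s t
    unfolding G_def using that by (rule continuous_on_zmap_iterate)
  \<comment> \<open>The outermost application is treated first: the interval between
    \<open>G c\<close> and \<open>G d\<close> shrinks to \<open>[p, q]\<close>, which has length at
    most 1 in a lap and otherwise is shorter by 2 than the difference of the values. Then
    \<open>p\<close> and \<open>q\<close> are lifted through \<open>G\<close>.\<close>
  have "\<exists>c1 d1. c \<le> c1 \<and> c1 \<le> d1 \<and> d1 \<le> d \<and> zmap P (G c1) = zmap P (G c) \<and> zmap P (G d1) = zmap P (G d) \<and>
      \<bar>G c1 - G d1\<bar> \<le> 2 * (real k + 1)"
  proof (cases "G c \<le> G d")
    case True
    obtain p q where pq: "G c \<le> p" "p \<le> q" "q \<le> G d" "zmap P p = zmap P (G c)" "zmap P q = zmap P (G d)"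
      "(\<exists>i. real i \<le> p \<and> q \<le> real i + 1) \<or> q - p + 2 \<le> \<bar>zmap P (G c) - zmap P (G d)\<bar>"
      by (rule zmap_crossing[OF Gpos[OF Suc.prems(1)] True])
    then have "\<bar>p - q\<bar> \<le> 2 * (real k + 1)" using Suc.prems(3) unfolding G by auto
    moreover obtain c1 where c1: "c \<le> c1" "c1 \<le> d" "G c1 = p"
      using IVT'[of G c p d] cont[of c d] pq Suc.prems by auto
    moreover obtain d1 where "c1 \<le> d1" "d1 \<le> d" "G d1 = q"
      using IVT'[of G c1 q d] cont[of c1 d] pq c1 Suc.prems by auto
    ultimately show ?thesis using pq by (intro exI[of _ c1] exI[of _ d1]) auto
  next
    case False
    then have "G d \<le> G c" and "0 \<le> d" using Suc.prems by auto
    obtain p q where pq: "G d \<le> p" "p \<le> q" "q \<le> G c" "zmap P p = zmap P (G d)" "zmap P q = zmap P (G c)"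
      "(\<exists>i. real i \<le> p \<and> q \<le> real i + 1) \<or> q - p + 2 \<le> \<bar>zmap P (G d) - zmap P (G c)\<bar>"
      by (rule zmap_crossing[OF Gpos[OF \<open>0 \<le> d\<close>] \<open>G d \<le> G c\<close>])
    then have "\<bar>p - q\<bar> \<le> 2 * (real k + 1)" using Suc.prems(3) unfolding G by auto
    moreover obtain c1 where c1: "c \<le> c1" "c1 \<le> d" "G c1 = q"
      using IVT2'[of G d q c] cont[of c d] pq Suc.prems by auto
    moreover obtain d1 where "c1 \<le> d1" "d1 \<le> d" "G d1 = p"
      using IVT2'[of G d p c1] cont[of c1 d] pq c1 Suc.prems by auto
    ultimately show ?thesis using pq by (intro exI[of _ c1] exI[of _ d1]) auto
  qed
  then obtain c1 d1 where 1: "c \<le> c1" "c1 \<le> d1" "d1 \<le> d" "zmap P (G c1) = zmap P (G c)" "zmap P (G d1) = zmap P (G d)"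
      "\<bar>G c1 - G d1\<bar> \<le> 2 * (real k + 1)" by blast
  then obtain c' d' where 2: "c1 \<le> c'" "c' \<le> d1" "c1 \<le> d'" "d' \<le> d1" "G c' = G c1" "G d' = G d1"
      "d' \<le> c' \<or> (\<exists>i. real i \<le> c' \<and> d' \<le> real i + 1)"
    using Suc.IH[of c1 d1, folded G_def] Suc.prems by auto
  show ?case unfolding G using 1 2 by (intro exI[of _ c'] exI[of _ d']) auto
qed

text \<open>The lap found by the crossing must have index \<open>i \<ge> k\<close>, both for the
  error \<open>1 / (i + 1)\<close> and to allow \<open>k\<close> applications after the first. This
  is arranged by moving \<open>c\<close> to the right.\<close>

lemma zmap_iterate_crooked:
  assumes cd: "0 \<le> c" "c \<le> d" and close: "\<bar>(zmap P ^^ Suc k) c - (zmap P ^^ Suc k) d\<bar> \<le> 2 * (real k + 1)"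
  shows "\<exists>u v. c \<le> u \<and> u \<le> v \<and> v \<le> d \<and> \<bar>(zmap P ^^ Suc k) u - (zmap P ^^ Suc k) d\<bar> \<le> 1 / (real k + 1) \<and>
    \<bar>(zmap P ^^ Suc k) v - (zmap P ^^ Suc k) c\<bar> \<le> 1 / (real k + 1)"
proof -
  define G where "G = zmap P ^^ Suc k"
  have zero: "G x = 0" if "0 \<le> x" "x \<le> real k + 1" for x
    using that zmap_iterate_le[of x "Suc k" P] zmap_iterate_nonneg[of x "Suc k" P] unfolding G_def by linarith
  have "\<exists>u v. c \<le> u \<and> u \<le> v \<and> v \<le> d \<and> \<bar>G u - G d\<bar> \<le> 1 / (real k + 1) \<and> \<bar>G v - G c\<bar> \<le> 1 / (real k + 1)"
  proof (cases "d \<le> real k + 1")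
    case True
    then show ?thesis using cd zero[of c] zero[of d] by (intro exI[of _ c]) auto
  next
    case False
    \<comment> \<open>The iterate vanishes on \<open>[0, k + 1]\<close>, so its value at
      \<open>c\<close> is kept.\<close>
    define c1 where "c1 = max c (real k + 1)"
    have Gc1: "G c1 = G c" using zero[of c] zero[of "real k + 1"] cd by (auto simp: c1_def max_def)
    have c1: "0 \<le> c1" "c \<le> c1" "c1 \<le> d" "real k + 1 \<le> c1" using cd False by (auto simp: c1_def)
    obtain c' d' where cd': "c1 \<le> c'" "c' \<le> d" "c1 \<le> d'" "d' \<le> d" "G c' = G c1" "G d' = G d"
      "d' \<le> c' \<or> (\<exists>i. real i \<le> c' \<and> d' \<le> real i + 1)"
      using zmap_iterate_crossing[OF c1(1,3), where P = P and k = k, folded G_def] close Gc1 unfolding G_def[symmetric] by auto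
    show ?thesis
    proof (cases "d' \<le> c'")
      case True
      then show ?thesis using cd' c1 Gc1 by (intro exI[of _ d'] exI[of _ c']) auto
    next
      case False
      then obtain i where i: "real i \<le> c'" "d' \<le> real i + 1" using cd' by auto
      then have "k \<le> i" using c1 cd' by linarith
      from crooked_onD[OF lap_iterate_crooked[OF this, where P = P] i(1) _ i(2), folded G_def] False
      obtain u v where uv: "c' \<le> u" "u \<le> v" "v \<le> d'" "\<bar>G u - G d'\<bar> \<le> 1 / (real i + 1)"
        "\<bar>G v - G c'\<bar> \<le> 1 / (real i + 1)" by auto
      have "1 / (real i + 1) \<le> 1 / (real k + 1)" using \<open>k \<le> i\<close> by (simp add: frac_le)
      then show ?thesis using uv cd' c1 Gc1 by (intro exI[of _ u] exI[of _ v]) auto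
    qed
  qed
  then show ?thesis unfolding G_def .
qed

section \<open>Transfer to the unit interval\<close>

definition squash :: "real \<Rightarrow> real" where
  "squash x = x / (1 + x)"

lemma squash_0 [simp]: "squash 0 = 0"
  by (simp add: squash_def)

lemma squash_range: "0 \<le> x \<Longrightarrow> 0 \<le> squash x \<and> squash x < 1"
  by (simp add: squash_def)

lemma squash_less_iff: "0 \<le> x \<Longrightarrow> 0 \<le> y \<Longrightarrow> squash x < squash y \<longleftrightarrow> x < y"
  by (simp add: squash_def field_simps)

lemma squash_le_iff: "0 \<le> x \<Longrightarrow> 0 \<le> y \<Longrightarrow> squash x \<le> squash y \<longleftrightarrow> x \<le> y"
  using squash_less_iff[of y x] by linarith

lemma squash_eq_iff: "0 \<le> x \<Longrightarrow> 0 \<le> y \<Longrightarrow> squash x = squash y \<longleftrightarrow> x = y"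
  using squash_less_iff[of x y] squash_less_iff[of y x] by linarith

text \<open>Error bounds on the half line thus remain valid on the unit interval.\<close>

lemma squash_contraction:
  assumes "0 \<le> x" "0 \<le> y"
  shows "\<bar>squash x - squash y\<bar> \<le> \<bar>x - y\<bar>"
proof -
  have "1 \<le> (1 + x) * (1 + y)" using assms by (simp add: algebra_simps)
  then have "\<bar>x - y\<bar> / ((1 + x) * (1 + y)) \<le> \<bar>x - y\<bar> / 1"
    by (intro divide_left_mono) auto
  moreover have "squash x - squash y = (x - y) / ((1 + x) * (1 + y))"
    using assms by (simp add: squash_def divide_simps) (simp add: algebra_simps)
  then have "\<bar>squash x - squash y\<bar> = \<bar>x - y\<bar> / ((1 + x) * (1 + y))"
    using assms by (simp add: abs_mult)
  ultimately show ?thesis by simp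
qed

lemma squash_unsquash: "x < 1 \<Longrightarrow> squash (x / (1 - x)) = x"
  by (simp add: squash_def divide_simps)

lemma unsquash_squash: "0 \<le> x \<Longrightarrow> squash x / (1 - squash x) = x"
  by (simp add: squash_def divide_simps)

lemma obtain_squash:
  assumes "0 \<le> x" "x < 1"
  obtains X where "0 \<le> X" "x = squash X"
  using that[of "x / (1 - x)"] squash_unsquash[of x] assms by simp

text \<open>The restricted abstraction gives membership in \<open>extensional\<close>. The point 1
  stands for infinity; elsewhere \<open>x / (1 - x)\<close> inverts \<open>squash\<close>.\<close>

definition imap :: "nat set \<Rightarrow> real \<Rightarrow> real" where
  "imap P = (\<lambda>x\<in>{0..1}. if x = 1 then 1 else squash (zmap P (x / (1 - x))))"

lemma imap_1 [simp]: "imap P 1 = 1"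
  by (simp add: imap_def)

lemma imap_squash: "0 \<le> X \<Longrightarrow> imap P (squash X) = squash (zmap P X)"
  using squash_range[of X] by (auto simp: imap_def unsquash_squash)

lemma imap_iterate_squash: "0 \<le> X \<Longrightarrow> (imap P ^^ n) (squash X) = squash ((zmap P ^^ n) X)"
  by (induction n) (auto simp: imap_squash zmap_iterate_nonneg)

lemma imap_iterate_1: "(imap P ^^ n) 1 = 1"
  by (induction n) auto

lemma imap_0 [simp]: "imap P 0 = 0"
  using imap_squash[of 0 P] zmap_le[of 0 P] zmap_nonneg[of P 0] by simp

lemma imap_less:
  assumes "0 < x" "x < 1"
  shows "imap P x < x"
proof -
  obtain X where X: "0 \<le> X" "x = squash X" using obtain_squash[of x] assms by auto
  then have "0 < X" using assms by (cases "X = 0") auto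
  then have "zmap P X < X" using zmap_le[of X P] by auto
  then show ?thesis using X by (simp add: imap_squash squash_less_iff zmap_nonneg)
qed

lemma imap_range:
  assumes "0 \<le> x" "x \<le> 1"
  shows "0 \<le> imap P x \<and> imap P x \<le> 1"
proof (cases "x = 1")
  case False
  obtain X where X: "0 \<le> X" "x = squash X" using obtain_squash[of x] assms False by auto
  then show ?thesis using squash_range[OF zmap_nonneg[of P X]] by (simp add: imap_squash)
qed simp

text \<open>On the half line \<open>1 - squash Y\<close> is \<open>1 / (1 + Y)\<close>, and a
  displacement of at most 9 lowers \<open>1 + X\<close> at most by the factor 10.\<close>

lemma imap_near_1:
  assumes "0 \<le> x" "x \<le> 1"
  shows "1 - imap P x \<le> 10 * (1 - x)"
proof (cases "x = 1")
  case False
  obtain X where X: "0 \<le> X" "x = squash X" using obtain_squash[of x] assms False by auto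
  have "1 + X \<le> 10 * (1 + zmap P X)" using zmap_ge[OF X(1), of P] zmap_nonneg[of P X] by argo
  then have "1 / (1 + zmap P X) \<le> 10 * (1 / (1 + X))"
    using X(1) zmap_nonneg[of P X] by (simp add: divide_simps)
  moreover have "1 - squash Y = 1 / (1 + Y)" if "0 \<le> Y" for Y
    using that by (simp add: squash_def divide_simps)
  ultimately show ?thesis
    using X zmap_nonneg[of P X] by (simp add: imap_squash)
qed simp

lemma continuous_on_imap: "continuous_on {0..1} (imap P)"
  unfolding continuous_on_eq_continuous_within
proof
  fix x :: real assume x: "x \<in> {0..1}"
  show "continuous (at x within {0..1}) (imap P)"
  proof (cases "x = 1")
    case True
    have "((\<lambda>t. 1 - imap P t) \<longlongrightarrow> 0) (at 1 within {0..1})"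
    proof (rule tendsto_sandwich[where f = "\<lambda>_. 0" and h = "\<lambda>t. 10 * (1 - t)"])
      show "\<forall>\<^sub>F t in at 1 within {0..1}. 0 \<le> 1 - imap P t"
        using imap_range[of _ P] by (auto simp: eventually_at_filter)
      show "\<forall>\<^sub>F t in at 1 within {0..1}. 1 - imap P t \<le> 10 * (1 - t)"
        using imap_near_1[of _ P] by (auto simp: eventually_at_filter)
      show "((\<lambda>t::real. 10 * (1 - t)) \<longlongrightarrow> 0) (at 1 within {0..1})"
        by (auto intro!: tendsto_eq_intros)
    qed simp
    from tendsto_diff[OF tendsto_const[of 1] this] show ?thesis
      using True by (simp add: continuous_within)
  next
    case False
    \<comment> \<open>Up to this point, halfway between \<open>x\<close> and 1, the denominator
      stays positive, and \<open>[0, r]\<close> is a neighbourhood of \<open>x\<close> in the unit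
      interval.\<close>
    define r where "r = (x + 1) / 2"
    have r: "x < r" "0 < r" "r < 1" using x False by (auto simp: r_def)
    have "continuous_on {0..r} (\<lambda>x. squash (zmap P (x / (1 - x))))"
    proof -
      have "continuous_on {0..r} (\<lambda>x. x / (1 - x))"
        using r by (auto intro!: continuous_intros)
      moreover have "(\<lambda>x. x / (1 - x)) ` {0..r} \<subseteq> {0..r / (1 - r)}"
        using r by (auto simp: divide_simps algebra_simps)
      ultimately have "continuous_on {0..r} (\<lambda>x. zmap P (x / (1 - x)))"
        by (rule continuous_on_compose2[OF continuous_on_zmap[OF order_refl]])
      then show ?thesis
        unfolding squash_def using zmap_nonneg by (intro continuous_intros) (auto simp: add_nonneg_eq_0_iff)
    qed
    then have "continuous_on {0..r} (imap P)"
      by (rule continuous_on_eq) (use r in \<open>auto simp: imap_def\<close>)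
    then have "continuous (at x within {0..r}) (imap P)"
      using x r by (simp add: continuous_on_eq_continuous_within)
    moreover have "at x within {0..r} = at x within {0..1}"
      by (rule at_within_nhd[of x "{..<r}"]) (use r in auto)
    ultimately show ?thesis by simp
  qed
qed

lemma zero_attracted_imap: "zero_attracted (imap P)"
proof -
  have "imap P ` {0..1} = {0..1}"
  proof
    show "imap P ` {0..1} \<subseteq> {0..1}" using imap_range by auto
    show "{0..1} \<subseteq> imap P ` {0..1}"
      using IVT'[of "imap P" 0 _ 1] continuous_on_imap[of P] by fastforce
  qed
  moreover have "imap P \<in> extensional unit_I" by (simp add: imap_def)
  ultimately show ?thesis
    using imap_less[of _ P] continuous_on_imap
    by (auto simp: zero_attracted_def interval_maps_def)
qed

section \<open>Crookedness on the unit interval\<close>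

lemma continuous_on_imap_iterate: "continuous_on {0..1} (imap P ^^ n)"
proof (induction n)
  case (Suc n)
  have "(imap P ^^ n) ` {0..1} \<subseteq> {0..1}"
    by (induction n) (use imap_range in \<open>auto simp: image_subset_iff\<close>)
  from continuous_on_compose2[OF continuous_on_imap Suc this] show ?case by (simp add: o_def)
qed (simp add: id_def)

text \<open>Both values come from \<open>[0, 2 * (k + 1)]\<close> on the half line, so they differ
  by no more than the distance allowed there.\<close>

lemma imap_iterate_crooked_low:
  assumes cd: "0 \<le> c" "c \<le> d" "d \<le> 1"
    and low: "(imap P ^^ Suc k) c \<le> squash (2 * (real k + 1))" "(imap P ^^ Suc k) d \<le> squash (2 * (real k + 1))"
  shows "\<exists>u v. c \<le> u \<and> u \<le> v \<and> v \<le> d \<and> \<bar>(imap P ^^ Suc k) u - (imap P ^^ Suc k) d\<bar> \<le> 1 / (real k + 1) \<and>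
    \<bar>(imap P ^^ Suc k) v - (imap P ^^ Suc k) c\<bar> \<le> 1 / (real k + 1)"
proof -
  define K where "K = 2 * (real k + 1)"
  define n where "n = Suc k"
  have K: "0 \<le> K" by (simp add: K_def)
  note low = low[folded K_def n_def]
  \<comment> \<open>The iterates fix 1, which lies above the bound; so \<open>c\<close> and
    \<open>d\<close> have counterparts on the half line.\<close>
  have "d \<noteq> 1" using low(2) imap_iterate_1[where P = P and n = n] squash_range[OF K] by auto
  then obtain C D where C: "0 \<le> C" "c = squash C" and D: "0 \<le> D" "d = squash D"
    using obtain_squash[of c] obtain_squash[of d] cd by (smt (verit))
  have CD: "C \<le> D" using C D cd by (simp add: squash_le_iff)
  have "(zmap P ^^ n) C \<le> K" "(zmap P ^^ n) D \<le> K"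
    using low C D K by (auto simp: imap_iterate_squash squash_le_iff zmap_iterate_nonneg)
  moreover have "0 \<le> (zmap P ^^ n) C" "0 \<le> (zmap P ^^ n) D" using C D by (auto simp: zmap_iterate_nonneg)
  ultimately have "\<bar>(zmap P ^^ n) C - (zmap P ^^ n) D\<bar> \<le> K" by linarith
  then obtain U V where UV: "C \<le> U" "U \<le> V" "V \<le> D"
    "\<bar>(zmap P ^^ n) U - (zmap P ^^ n) D\<bar> \<le> 1 / (real k + 1)" "\<bar>(zmap P ^^ n) V - (zmap P ^^ n) C\<bar> \<le> 1 / (real k + 1)"
    using zmap_iterate_crooked[OF C(1) CD, where P = P and k = k] unfolding n_def K_def by auto
  have sq: "\<bar>(imap P ^^ n) (squash s) - (imap P ^^ n) (squash t)\<bar> \<le> \<bar>(zmap P ^^ n) s - (zmap P ^^ n) t\<bar>"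
    if "0 \<le> s" "0 \<le> t" for s t
    using squash_contraction[of "(zmap P ^^ n) s" "(zmap P ^^ n) t"] that
    by (simp add: imap_iterate_squash zmap_iterate_nonneg)
  show ?thesis unfolding n_def[symmetric]
    using UV C D sq[of U D] sq[of V C]
    by (intro exI[of _ "squash U"] exI[of _ "squash V"]) (auto simp: squash_le_iff)
qed

text \<open>Values above the cut-off \<open>\<kappa>\<close> are within \<open>\<delta> / 2\<close>
  of 1. A pair with one high value is cut at a point \<open>e\<close> with value
  \<open>\<kappa>\<close>, and the two errors below \<open>\<delta> / 2\<close> add up. For two high
  values, \<open>u = v = c\<close> will do.\<close>

lemma crooked_imap: "crooked (imap P)"
  unfolding crooked_def
proof (intro allI impI)
  fix \<delta> :: real assume "0 < \<delta>"
  then obtain k where k: "inverse (real (Suc k)) < \<delta> / 2" using reals_Archimedean[of "\<delta> / 2"] by auto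
  define g where "g = imap P ^^ Suc k"
  define \<kappa> where "\<kappa> = squash (2 * (real k + 1))"
  have tol: "1 / (real k + 1) < \<delta> / 2" using k by (simp add: inverse_eq_divide add.commute)
  have "1 - \<kappa> = 1 / (2 * (real k + 1) + 1)" unfolding \<kappa>_def squash_def by (simp add: divide_simps)
  also have "\<dots> \<le> 1 / (real k + 1)" by (intro divide_left_mono) auto
  finally have \<kappa>: "1 - \<kappa> < \<delta> / 2" using tol by linarith
  have g_range: "0 \<le> g x \<and> g x \<le> 1" if "0 \<le> x" "x \<le> 1" for x
  proof -
    have "0 \<le> (imap P ^^ n) x \<and> (imap P ^^ n) x \<le> 1" for n
      by (induction n) (use that imap_range in auto)
    then show ?thesis unfolding g_def .
  qed
  have cont: "continuous_on {s..t} g" if "0 \<le> s" "t \<le> 1" for s t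
    unfolding g_def by (rule continuous_on_subset[OF continuous_on_imap_iterate]) (use that in auto)
  have low: "\<exists>u v. c \<le> u \<and> u \<le> v \<and> v \<le> d \<and> \<bar>g u - g d\<bar> \<le> 1 / (real k + 1) \<and> \<bar>g v - g c\<bar> \<le> 1 / (real k + 1)"
    if "0 \<le> c" "c \<le> d" "d \<le> 1" "g c \<le> \<kappa>" "g d \<le> \<kappa>" for c d
    using imap_iterate_crooked_low[where c = c and d = d and P = P and k = k] that unfolding g_def \<kappa>_def by simp
  have main: "\<exists>u v. c \<le> u \<and> u \<le> v \<and> v \<le> d \<and> \<bar>g u - g d\<bar> < \<delta> \<and> \<bar>g v - g c\<bar> < \<delta>"
    if cd: "0 \<le> c" "c \<le> d" "d \<le> 1" for c d
  proof -
    have r: "g c \<le> 1" "g d \<le> 1" using g_range[of c] g_range[of d] cd by auto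
    consider "g c \<le> \<kappa>" "g d \<le> \<kappa>" | "g c \<le> \<kappa>" "\<kappa> \<le> g d" | "\<kappa> \<le> g c" "g d \<le> \<kappa>" | "\<kappa> \<le> g c" "\<kappa> \<le> g d"
      by linarith
    then show ?thesis
    proof cases
      case 1
      then obtain u v where "c \<le> u" "u \<le> v" "v \<le> d" "\<bar>g u - g d\<bar> \<le> 1 / (real k + 1)" "\<bar>g v - g c\<bar> \<le> 1 / (real k + 1)"
        using low[OF cd] by auto
      then show ?thesis using tol \<open>0 < \<delta>\<close> by (intro exI[of _ u] exI[of _ v]) auto
    next
      case 2
      obtain e where e: "c \<le> e" "e \<le> d" "g e = \<kappa>"
        using IVT'[of g c \<kappa> d] cont[of c d] 2 cd by auto
      then obtain u v where "c \<le> u" "u \<le> v" "v \<le> e" "\<bar>g u - g e\<bar> \<le> 1 / (real k + 1)" "\<bar>g v - g c\<bar> \<le> 1 / (real k + 1)"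
        using low[of c e] cd 2 by auto
      then show ?thesis using tol \<kappa> e 2 r \<open>0 < \<delta>\<close> by (intro exI[of _ u] exI[of _ v]) auto
    next
      case 3
      obtain e where e: "c \<le> e" "e \<le> d" "g e = \<kappa>"
        using IVT2'[of g d \<kappa> c] cont[of c d] 3 cd by auto
      then obtain u v where "e \<le> u" "u \<le> v" "v \<le> d" "\<bar>g u - g d\<bar> \<le> 1 / (real k + 1)" "\<bar>g v - g e\<bar> \<le> 1 / (real k + 1)"
        using low[of e d] cd 3 by auto
      then show ?thesis using tol \<kappa> e 3 r \<open>0 < \<delta>\<close> by (intro exI[of _ u] exI[of _ v]) auto
    next
      case 4
      then show ?thesis using \<kappa> r cd \<open>0 < \<delta>\<close> by (intro exI[of _ c]) auto
    qed
  qed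
  have "delta_crooked \<delta> g"
    unfolding delta_crooked_def delta_crooked_between_def
  proof (intro ballI impI, elim conjE)
    fix a b c d assume I: "c \<in> {0..1}" "d \<in> {0..1}" and ab: "g c = a" "g d = b"
    show "\<exists>c'\<in>closed_segment c d. \<exists>d'\<in>closed_segment c' d. \<bar>b - g c'\<bar> < \<delta> \<and> \<bar>a - g d'\<bar> < \<delta>"
    proof (cases "c \<le> d")
      case True
      then obtain u v where "c \<le> u" "u \<le> v" "v \<le> d" "\<bar>g u - g d\<bar> < \<delta>" "\<bar>g v - g c\<bar> < \<delta>"
        using main[of c d] I by auto
      then show ?thesis using True ab
        by (intro bexI[of _ u] bexI[of _ v]) (auto simp: closed_segment_eq_real_ivl)
    next
      case False
      \<comment> \<open>With the ends in reverse order the two points exchange roles.\<close>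
      then obtain u v where "d \<le> u" "u \<le> v" "v \<le> c" "\<bar>g u - g c\<bar> < \<delta>" "\<bar>g v - g d\<bar> < \<delta>"
        using main[of d c] I by auto
      then show ?thesis using False ab
        by (intro bexI[of _ v] bexI[of _ u]) (auto simp: closed_segment_eq_real_ivl)
    qed
  qed
  then show "\<exists>n\<ge>1. delta_crooked \<delta> (imap P ^^ n)" unfolding g_def by (intro exI[of _ "Suc k"]) auto
qed

section \<open>A conjugacy invariant\<close>

text \<open>For a map fixing 0, these are the \<open>m\<close> such that some plateau reaches 0
  after exactly \<open>m + 2\<close> steps. Plateaus at height 0 then do not count, as the first
  iterate is already nonzero.\<close>

definition plateau_times :: "(real \<Rightarrow> real) \<Rightarrow> nat set" where
  "plateau_times f = {m. \<exists>x y. 0 \<le> x \<and> x < y \<and> y \<le> 1 \<and> (\<forall>t\<in>{x..y}. f t = f x) \<and>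
     (f ^^ Suc m) x \<noteq> 0 \<and> (f ^^ Suc (Suc m)) x = 0}"

lemma plateau_timesE:
  assumes "m \<in> plateau_times f"
  obtains x y where "0 \<le> x" "x < y" "y \<le> 1" "\<forall>t\<in>{x..y}. f t = f x"
    "(f ^^ Suc m) x \<noteq> 0" "(f ^^ Suc (Suc m)) x = 0"
  using assms unfolding plateau_times_def by blast

lemma conjugate_maps_sym:
  assumes "conjugate_maps f g" "f ` unit_I \<subseteq> unit_I"
  shows "conjugate_maps g f"
proof -
  obtain h k where hk: "homeomorphism unit_I unit_I h k" and g: "\<And>x. x \<in> unit_I \<Longrightarrow> g x = h (f (k x))"
    using assms(1) unfolding conjugate_maps_def by blast
  have "f x = k (g (h x))" if "x \<in> unit_I" for x
  proof -
    have "h x \<in> unit_I" "k (h x) = x" using hk that unfolding homeomorphism_def by auto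
    moreover have "f x \<in> unit_I" using that assms(2) by blast
    then have "k (h (f x)) = f x" using hk unfolding homeomorphism_def by auto
    ultimately show ?thesis using g[of "h x"] by simp
  qed
  then show ?thesis using homeomorphism_symD[OF hk] unfolding conjugate_maps_def by blast
qed

text \<open>\<open>h\<close> carries plateaus to plateaus and orbits to orbits, so the point is that
  \<open>h 0 = 0\<close>; the zero \<open>r\<close> in the open interval serves to show
  this.\<close>

lemma plateau_times_conjugate:
  assumes conj: "conjugate_maps f g" and f: "zero_attracted f" and g: "zero_attracted g"
    and r: "0 < r" "r < 1" "f r = 0"
  shows "plateau_times f \<subseteq> plateau_times g"
proof
  obtain h k where hk: "homeomorphism unit_I unit_I h k" and gh: "\<And>x. x \<in> unit_I \<Longrightarrow> g x = h (f (k x))"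
    using conj unfolding conjugate_maps_def by blast
  have h_in: "h x \<in> unit_I" if "x \<in> unit_I" for x using hk that unfolding homeomorphism_def by auto
  have inj: "h x = h y \<longleftrightarrow> x = y" if "x \<in> unit_I" "y \<in> unit_I" for x y
  proof -
    have "k (h x) = x" "k (h y) = y" using hk that unfolding homeomorphism_def by auto
    then show ?thesis by metis
  qed
  have f_in: "f x \<in> unit_I" if "x \<in> unit_I" for x using f that unfolding zero_attracted_def interval_maps_def by auto
  have semi: "g (h x) = h (f x)" if "x \<in> unit_I" for x
    using gh[OF h_in[OF that]] hk that unfolding homeomorphism_def by auto
  have g_less: "g x < x" if "0 < x" "x < 1" for x
    using g that unfolding zero_attracted_def by auto
  \<comment> \<open>\<open>h 0\<close> is a fixed point of \<open>g\<close>, hence 0 or 1. If it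
    were 1, then \<open>h r\<close> would differ from 1 and yet have value 1 under \<open>g\<close>,
    which fixes 0 and lies below the diagonal inside.\<close>
  have "h 0 = 0"
  proof (rule ccontr)
    assume "h 0 \<noteq> 0"
    moreover have "g (h 0) = h 0" using semi[of 0] f by (simp add: zero_attracted_def)
    ultimately have "h 0 = 1" using g_less[of "h 0"] h_in[of 0] by (cases "h 0 < 1") auto
    then have "g (h r) = 1" "h r \<noteq> 1" using semi[of r] inj[of r 0] r by auto
    moreover have "g 0 = 0" using g by (simp add: zero_attracted_def)
    ultimately show False using g_less[of "h r"] h_in[of r] r by (cases "h r = 0") auto
  qed
  have iter_in: "(f ^^ n) x \<in> unit_I" if "x \<in> unit_I" for n x
    by (induction n) (use that f_in in auto)
  have iter: "(g ^^ n) (h x) = h ((f ^^ n) x)" if "x \<in> unit_I" for n x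
    by (induction n) (use semi iter_in that in auto)
  fix m assume "m \<in> plateau_times f"
  then obtain x y where xy: "0 \<le> x" "x < y" "y \<le> 1" and const: "\<forall>t\<in>{x..y}. f t = f x"
    and m: "(f ^^ Suc m) x \<noteq> 0" "(f ^^ Suc (Suc m)) x = 0"
    by (rule plateau_timesE)
  \<comment> \<open>\<open>h\<close> has not been shown to be increasing, so the images of the end
    points are sorted.\<close>
  define x' y' where "x' = min (h x) (h y)" and "y' = max (h x) (h y)"
  have "h x \<noteq> h y" using inj[of x y] xy by auto
  then have x'y': "0 \<le> x'" "x' < y'" "y' \<le> 1" using h_in[of x] h_in[of y] xy unfolding x'_def y'_def by auto
  have "connected (h ` {x..y})"
    by (rule connected_continuous_image)
       (use hk xy in \<open>auto simp: homeomorphism_def intro: continuous_on_subset\<close>)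
  then have image: "{x'..y'} \<subseteq> h ` {x..y}"
    by (rule connected_contains_Icc) (use xy in \<open>auto simp: x'_def y'_def min_def max_def\<close>)
  obtain t where t: "t \<in> {x..y}" "x' = h t"
  proof -
    have "x' \<in> {x'..y'}" using x'y' by simp
    with image have "x' \<in> h ` {x..y}" by blast
    with that show ?thesis by blast
  qed
  have const': "g s = g x'" if "s \<in> {x'..y'}" for s
  proof -
    obtain t' where "t' \<in> {x..y}" "s = h t'" using image \<open>s \<in> {x'..y'}\<close> by auto
    moreover have "t \<in> unit_I" "t' \<in> unit_I" using t \<open>t' \<in> {x..y}\<close> xy by auto
    ultimately have "g s = h (f t')" "g x' = h (f t)" unfolding t(2) by (simp_all add: semi)
    then show ?thesis by (simp only: bspec[OF const t(1)] bspec[OF const \<open>t' \<in> {x..y}\<close>])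
  qed
  have iter': "(g ^^ Suc n) x' = h ((f ^^ Suc n) x)" for n
  proof -
    have "(f ^^ Suc n) t = (f ^^ Suc n) x" using bspec[OF const t(1)] by (simp add: funpow_swap1)
    then show ?thesis using iter[of t "Suc n"] t xy by simp
  qed
  have "(g ^^ Suc m) x' \<noteq> 0"
    using inj[of "(f ^^ Suc m) x" 0] iter_in[of x "Suc m"] m(1) xy unfolding iter' \<open>h 0 = 0\<close>
    by (simp del: funpow.simps)
  moreover have "(g ^^ Suc (Suc m)) x' = 0" unfolding iter' m(2) by (rule \<open>h 0 = 0\<close>)
  ultimately show "m \<in> plateau_times g"
    unfolding plateau_times_def mem_Collect_eq using x'y' const'
    by (intro exI[of _ x'] exI[of _ y'] conjI ballI)
qed

text \<open>Outside the paused quarters a positive value is taken only finitely often on each lap,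
  so an interval of constancy meets a paused quarter, where the value is that of the vertex.
  Positivity keeps the clipping out.\<close>

lemma zmap_plateau:
  assumes xy: "0 \<le> x" "x < y" and const: "\<And>t. x \<le> t \<Longrightarrow> t \<le> y \<Longrightarrow> zmap P t = v" and "0 < v"
  obtains j where "j \<in> P" "zmap P (real j) = v"
proof -
  \<comment> \<open>The solutions in lap \<open>i\<close> outside the paused quarter, where
    \<open>pause\<close> is injective.\<close>
  define A where "A i = {t. real i \<le> t \<and> t \<le> real i + 1 \<and> zmap P t = v \<and> \<not> (i \<in> P \<and> t \<le> real i + 1/4)}" for i
  have "finite (A i)" for i
  proof (rule finite_imageD)
    define \<Delta> where "\<Delta> = vertex (Suc i) - vertex i"
    have "\<Delta> \<noteq> 0" by (simp add: \<Delta>_def vertex_def)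
    have "zig (depth i) (pause P i (t - real i)) = (v - vertex i) / \<Delta>" if "t \<in> A i" for t
    proof -
      have "lap P i t = v" using that zmap_lap[of i t P] \<open>0 < v\<close> unfolding A_def by auto
      then show ?thesis using \<open>\<Delta> \<noteq> 0\<close> by (simp add: lap_def \<Delta>_def field_simps)
    qed
    then have "(\<lambda>t. pause P i (t - real i)) ` A i \<subseteq> {s. 0 \<le> s \<and> s \<le> 1 \<and> zig (depth i) s = (v - vertex i) / \<Delta>}"
      using pause_range[of _ P i] by (auto simp: A_def)
    then show "finite ((\<lambda>t. pause P i (t - real i)) ` A i)"
      by (rule finite_subset) (rule finite_zig_level)
    show "inj_on (\<lambda>t. pause P i (t - real i)) (A i)"
    proof (rule inj_onI)
      fix s t assume "s \<in> A i" "t \<in> A i" "pause P i (s - real i) = pause P i (t - real i)"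
      then show "s = t" by (cases "i \<in> P") (auto simp: A_def pause_def)
    qed
  qed
  moreover obtain N where N: "y < real N" using reals_Archimedean2 by blast
  ultimately have "finite (\<Union>i<N. A i)" by blast
  moreover have "infinite {x..y}" using xy(2) by simp
  ultimately have "\<not> {x..y} \<subseteq> (\<Union>i<N. A i)" using finite_subset by blast
  then obtain t where t: "t \<in> {x..y}" "t \<notin> (\<Union>i<N. A i)" by blast
  obtain i where i: "real i \<le> t" "t < real i + 1" using real_in_lap[of t] t xy by auto
  then have "i < N" using t N by auto
  then have "i \<in> P" "t \<le> real i + 1/4" using t i const[of t] by (auto simp: A_def)
  moreover have "zmap P t = zmap P (real i)"
    using calculation i by (simp add: zmap_lap[of i] lap_def pause_def)
  ultimately show ?thesis using that[of i] const[of t] t by auto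
qed

text \<open>Odd vertices from 3 on step down by 2, whatever \<open>P\<close> is. This gives the time
  at which a plateau starting there reaches 0.\<close>

lemma zmap_iterate_odd: "(zmap P ^^ n) (real (2 * (a + n) + 1)) = real (2 * a + 1)"
proof (induction n arbitrary: a)
  case (Suc n)
  have "(zmap P ^^ Suc n) (real (2 * (a + Suc n) + 1)) = zmap P ((zmap P ^^ n) (real (2 * (Suc a + n) + 1)))"
    by simp
  also have "\<dots> = zmap P (real (2 * Suc a + 1))" unfolding Suc.IH ..
  also have "\<dots> = real (2 * a + 1)" unfolding zmap_nat by (simp add: vertex_def)
  finally show ?case .
qed simp

lemma zmap_iterate_zero:
  assumes "(zmap P ^^ n) x = 0" "n \<le> n'"
  shows "(zmap P ^^ n') x = 0"
  using assms(2)
proof (induction n' rule: dec_induct)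
  case (step n')
  then show ?case using zmap_le[of 0 P] zmap_nonneg[of P 0] by simp
qed (use assms in simp)

text \<open>The plateau starting at \<open>2 * m + 3\<close> is at 1 after \<open>m + 1\<close>
  steps and at 0 after one more. Conversely, any plateau that counts shares its value with a vertex
  in \<open>P\<close>, hence also the later orbit and the time.\<close>

lemma plateau_times_imap: "plateau_times (imap ((\<lambda>m. 2 * m + 3) ` S)) = S"
proof -
  define P where "P = (\<lambda>m::nat. 2 * m + 3) ` S"
  have one: "(zmap P ^^ Suc m) (real (2 * m + 3)) = 1" for m
  proof -
    have "real (2 * m + 3) = real (2 * (0 + Suc m) + 1)" by simp
    then show ?thesis by (simp only: zmap_iterate_odd)
  qed
  have zero: "(zmap P ^^ Suc (Suc m)) (real (2 * m + 3)) = 0" for m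
    unfolding funpow.simps(2)[of "Suc m"] o_apply one using zmap_le[of 1 P] zmap_nonneg[of P 1] by simp
  have "m \<in> plateau_times (imap P)" if "m \<in> S" for m
  proof -
    define j where "j = 2 * m + 3"
    have "j \<in> P" using that by (simp add: P_def j_def)
    have "imap P t = imap P (squash (real j))" if t: "t \<in> {squash (real j)..squash (real j + 1/4)}" for t
    proof -
      have "0 \<le> t" "t < 1" using t squash_range[of "real j"] squash_range[of "real j + 1/4"] by auto
      then obtain T where T: "0 \<le> T" "t = squash T" by (rule obtain_squash)
      then have "real j \<le> T" "T \<le> real j + 1/4" using t by (auto simp: squash_le_iff)
      then have "zmap P T = zmap P (real j)"
        using \<open>j \<in> P\<close> by (simp add: zmap_lap[of j] lap_def pause_def)
      then show ?thesis using T by (simp add: imap_squash)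
    qed
    moreover have "(imap P ^^ Suc m) (squash (real j)) \<noteq> 0" "(imap P ^^ Suc (Suc m)) (squash (real j)) = 0"
      unfolding imap_iterate_squash[OF of_nat_0_le_iff] unfolding j_def one zero by (simp_all add: squash_def)
    moreover have "0 \<le> squash (real j)" "squash (real j) < squash (real j + 1/4)" "squash (real j + 1/4) \<le> 1"
      using squash_range[of "real j"] squash_range[of "real j + 1/4"] by (auto simp: squash_less_iff)
    ultimately show ?thesis unfolding plateau_times_def
      by (intro CollectI exI[of _ "squash (real j)"] exI[of _ "squash (real j + 1/4)"] conjI ballI)
  qed
  moreover have "m \<in> S" if times: "m \<in> plateau_times (imap P)" for m
  proof -
    obtain x y where xy: "0 \<le> x" "x < y" "y \<le> 1" and const: "\<forall>t\<in>{x..y}. imap P t = imap P x"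
      and m: "(imap P ^^ Suc m) x \<noteq> 0" "(imap P ^^ Suc (Suc m)) x = 0"
      by (rule plateau_timesE[OF times])
    \<comment> \<open>\<open>z\<close> replaces \<open>y\<close>, which may be 1 and then has no
      counterpart on the half line.\<close>
    obtain z where z: "x < z" "z < y" using dense[OF xy(2)] by auto
    have "x < 1" "0 \<le> z" "z < 1" using xy z by auto
    obtain X where X: "0 \<le> X" "x = squash X" by (rule obtain_squash[OF xy(1) \<open>x < 1\<close>])
    obtain Y where Y: "0 \<le> Y" "z = squash Y" by (rule obtain_squash[OF \<open>0 \<le> z\<close> \<open>z < 1\<close>])
    have "squash X < squash Y" using z(1) unfolding X(2) Y(2) .
    then have "X < Y" using X Y by (simp add: squash_less_iff)
    have constZ: "zmap P T = zmap P X" if "X \<le> T" "T \<le> Y" for T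
    proof -
      have "squash X \<le> squash T" "squash T \<le> squash Y"
        using that X(1) Y(1) by (simp_all add: squash_le_iff)
      then have "squash T \<in> {x..y}" unfolding X(2)[symmetric] Y(2)[symmetric] using z by simp
      then have "squash (zmap P T) = squash (zmap P X)"
        using bspec[OF const, of "squash T"] that X by (simp add: imap_squash)
      then show ?thesis by (simp add: squash_eq_iff zmap_nonneg)
    qed
    have squash_eq_0: "squash z = 0 \<longleftrightarrow> z = 0" if "0 \<le> z" for z
      using squash_eq_iff[of z 0] that by simp
    have mZ: "(zmap P ^^ Suc m) X \<noteq> 0" "(zmap P ^^ Suc (Suc m)) X = 0"
      using m unfolding X(2) imap_iterate_squash[OF X(1)] squash_eq_0[OF zmap_iterate_nonneg[OF X(1)]]
      by (simp_all only: not_False_eq_True)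
    have "zmap P X \<noteq> 0"
    proof
      assume "zmap P X = 0"
      then have "(zmap P ^^ 1) X = 0" by simp
      from zmap_iterate_zero[OF this, of "Suc m"] mZ(1) show False by linarith
    qed
    then have "0 < zmap P X" using zmap_nonneg[of P X] by linarith
    then obtain j where j: "j \<in> P" "zmap P (real j) = zmap P X"
      using zmap_plateau[OF X(1) \<open>X < Y\<close> constZ \<open>0 < zmap P X\<close>] by metis
    obtain a where a: "a \<in> S" "j = 2 * a + 3" using j(1) unfolding P_def by auto
    have same: "(zmap P ^^ Suc n) (real j) = (zmap P ^^ Suc n) X" for n
      using j(2) by (simp add: funpow_swap1)
    \<comment> \<open>An orbit stays at 0 once it is there, so neither arrival can precede the
      other.\<close>
    have "\<not> Suc (Suc a) \<le> Suc m"
      using zmap_iterate_zero[OF zero[of a]] mZ(1) unfolding same[symmetric] a(2) by metis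
    moreover have "\<not> Suc (Suc m) \<le> Suc a"
      using zmap_iterate_zero[OF mZ(2)[folded same]] one[of a] unfolding a(2) by (metis zero_neq_one)
    ultimately have "m = a" by linarith
    then show ?thesis using a by simp
  qed
  ultimately show ?thesis unfolding P_def by blast
qed

section \<open>The uncountable family\<close>

lemma imap_vanishes: "imap P (1 / 2) = 0"
  using imap_squash[of 1 P] zmap_le[of 1 P] zmap_nonneg[of P 1] by (simp add: squash_def)

lemma uncountable_nat_sets: "uncountable (UNIV :: nat set set)"
  unfolding uncountable_def using Cantors_theorem[of "UNIV :: nat set"] by auto

theorem theorem4p2:
  shows "\<exists>T. T \<subseteq> interval_maps \<and> uncountable T \<and>
    (\<forall>f\<in>T. crooked f \<and> zero_attracted f) \<and>
    (\<forall>f\<in>T. \<forall>g\<in>T. f \<noteq> g \<longrightarrow> \<not> conjugate_maps f g)"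
proof (intro exI conjI)
  \<comment> \<open>Plateaus start at odd vertices from 3 on, because vertex 1 already has value
    0.\<close>
  define F where "F S = imap ((\<lambda>m. 2 * m + 3) ` S)" for S
  have times: "plateau_times (F S) = S" for S unfolding F_def by (rule plateau_times_imap)
  have attracted: "zero_attracted (F S)" for S unfolding F_def by (rule zero_attracted_imap)
  \<comment> \<open>The point 1/2, sent to 0 by every map of the family, serves as
    \<open>r\<close>.\<close>
  have conj_le: "S \<subseteq> S'" if "conjugate_maps (F S) (F S')" for S S'
    using plateau_times_conjugate[OF that attracted attracted, of "1/2"] imap_vanishes
    unfolding times by (simp add: F_def)
  show "range F \<subseteq> interval_maps"
    using attracted by (auto simp: zero_attracted_def)
  show "uncountable (range F)"
  proof
    assume "countable (range F)"
    \<comment> \<open>\<open>plateau_times\<close> recovers \<open>S\<close> and so maps the family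
      onto all sets of numbers.\<close>
    then have "countable (plateau_times ` range F)" by (rule countable_image)
    moreover have "plateau_times ` range F = UNIV" using times by (auto simp: image_image)
    ultimately show False using uncountable_nat_sets by simp
  qed
  show "\<forall>f\<in>range F. crooked f \<and> zero_attracted f"
    using attracted crooked_imap by (auto simp: F_def)
  show "\<forall>f\<in>range F. \<forall>g\<in>range F. f \<noteq> g \<longrightarrow> \<not> conjugate_maps f g"
  proof (intro ballI impI notI)
    fix f g assume "f \<in> range F" "g \<in> range F" "f \<noteq> g" and conj: "conjugate_maps f g"
    then obtain S S' where S: "f = F S" "g = F S'" by auto
    have "conjugate_maps g f"
      using conjugate_maps_sym[OF conj] attracted S by (auto simp: zero_attracted_def interval_maps_def)
    then have "S = S'" using conj conj_le S by blast
    then show False using \<open>f \<noteq> g\<close> S by simp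
  qed
qed

end
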